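(* Let $\theta$ be a bounded real measurable periodic function of period 1 with $\int_0^1\theta(s)\,ds=0$ and $\int_0^1\theta^2(s)\,ds=1$, and let $R_n$ be the isometry of $L^2_{\mathbb{C}}(m)$ associated with $\theta$ defined in the context. For all $X\in\mathcal{D}(A)$, as $n\to\infty$, $$n^2\,\mathbb{E}\big[|R_n(X)-X|^2\big]\to2\mathcal{E}[X],$$ where $\mathcal{E}$ is the Dirichlet form associated with the Ornstein-Uhlenbeck operator $A$.
   Context: $m$ is the Wiener measure on $\mathcal{C}([0,1],\mathbb{R})$, $B$ the coordinate Brownian motion, $\mathbb{E}$ the expectation under $m$. $R_n:L^2_{\mathbb{C}}(m)\to L^2_{\mathbb{C}}(m)$ is the linear isometry defined by its action on the chaos: it is the identity on constants, and if $X=\int_{s_1<\cdots<s_k}\hat f(s_1,\dots,s_k)\,dB_{s_1}\cdots dB_{s_k}$ with $\hat f\in L^2_{sym}([0,1]^k,\mathbb{C})$, then $$R_n(X)=\int_{s_1<\cdots<s_k}\hat f(s_1,\dots,s_k)\,e^{\frac in\theta(ns_1)}dB_{s_1}\cdots e^{\frac in\theta(ns_k)}dB_{s_k}.$$ $A$ is the Ornstein-Uhlenbeck operator on $L^2_{\mathbb{C}}(m)$, acting on the $k$-th Wiener chaos as multiplication by $-\frac k2$, with domain $\mathcal{D}(A)$; its Dirichlet form is $\mathcal{E}[X]=-\mathbb{E}[\overline{X}\,AX]=\frac12\mathbb{E}\int_0^1|D_sX|^2\,ds$ for $X\in\mathcal{D}(A)$, with $D$ the Malliavin derivative. *)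

theory Defs
  imports "HOL-Probability.Probability"
begin

text \<open>Elements of \<open>L\<^sup>2\<close> are represented by square integrable functions; two representatives
  of the same class are equal almost everywhere.\<close>

definition L2 :: "'a measure \<Rightarrow> ('a \<Rightarrow> complex) set" where
  "L2 M = {X \<in> borel_measurable M. integrable M (\<lambda>\<omega>. (cmod (X \<omega>))\<^sup>2)}"

definition L2_tendsto :: "'a measure \<Rightarrow> (nat \<Rightarrow> 'a \<Rightarrow> complex) \<Rightarrow> ('a \<Rightarrow> complex) \<Rightarrow> bool" where
  "L2_tendsto M Xs X \<longleftrightarrow>
     (\<forall>N. Xs N \<in> L2 M) \<and> X \<in> L2 M \<and>
     (\<lambda>N. LINT \<omega>|M. (cmod (Xs N \<omega> - X \<omega>))\<^sup>2) \<longlonglongrightarrow> 0"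

definition L2_linear_isometry :: "'a measure \<Rightarrow> (('a \<Rightarrow> complex) \<Rightarrow> ('a \<Rightarrow> complex)) \<Rightarrow> bool" where
  "L2_linear_isometry M R \<longleftrightarrow>
     (\<forall>X\<in>L2 M. R X \<in> L2 M) \<and>
     (\<forall>X\<in>L2 M. \<forall>Y\<in>L2 M. \<forall>a b. AE \<omega> in M. R (\<lambda>\<omega>. a * X \<omega> + b * Y \<omega>) \<omega> = a * R X \<omega> + b * R Y \<omega>) \<and>
     (\<forall>X\<in>L2 M. (LINT \<omega>|M. (cmod (R X \<omega>))\<^sup>2) = (LINT \<omega>|M. (cmod (X \<omega>))\<^sup>2))"

text \<open>Paths are functions on \<open>[0,1]\<close>, normalised to \<^const>\<open>undefined\<close> elsewhere. The
  \<open>\<sigma>\<close>-algebra generated by the evaluations is the Borel \<open>\<sigma>\<close>-algebra of the uniform norm.\<close>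

definition C01 :: "(real \<Rightarrow> real) set" where
  "C01 = {\<omega> \<in> extensional {0..1}. continuous_on {0..1} \<omega>}"

definition wiener_measure :: "(real \<Rightarrow> real) measure \<Rightarrow> bool" where
  "wiener_measure M \<longleftrightarrow>
     prob_space M \<and>
     sets M = sets (restrict_space (Pi\<^sub>M {0..1} (\<lambda>_. borel)) C01) \<and>
     (AE \<omega> in M. \<omega> 0 = 0) \<and>
     (\<forall>s t. 0 \<le> s \<longrightarrow> s < t \<longrightarrow> t \<le> 1 \<longrightarrow>
        distributed M lborel (\<lambda>\<omega>. \<omega> t - \<omega> s) (normal_density 0 (sqrt (t - s)))) \<and>
     (\<forall>(t :: nat \<Rightarrow> real) N. (\<forall>i\<le>N. t i \<in> {0..1}) \<longrightarrow> (\<forall>i<N. t i < t (Suc i)) \<longrightarrow>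
        prob_space.indep_vars M (\<lambda>_. borel) (\<lambda>i \<omega>. \<omega> (t (Suc i)) - \<omega> (t i)) {..<N})"

definition cube_measure :: "nat \<Rightarrow> (nat \<Rightarrow> real) measure" where
  "cube_measure k = Pi\<^sub>M {..<k} (\<lambda>_. restrict_space lborel {0..1})"

definition simplex_measure :: "nat \<Rightarrow> (nat \<Rightarrow> real) measure" where
  "simplex_measure k = restrict_space (cube_measure k) {s. \<forall>j<k. \<forall>i<j. s i < s j}"

definition L2_sym :: "nat \<Rightarrow> ((nat \<Rightarrow> real) \<Rightarrow> complex) set" where
  "L2_sym k = {f \<in> L2 (cube_measure k).
     AE s in cube_measure k. \<forall>p. p permutes {..<k} \<longrightarrow> f (s \<circ> p) = f s}"

text \<open>A list of triples \<open>(c, a, b)\<close> encodes the elementary integrand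
  \<open>\<Sum> c \<cdot> 1\<^bsub>(a\<^sub>0,b\<^sub>0] \<times> \<dots> \<times> (a\<^bsub>k-1\<^esub>,b\<^bsub>k-1\<^esub>]\<^esub>\<close>. The boxes are required to lie in the open simplex
  (\<open>b\<^sub>i \<le> a\<^bsub>i+1\<^esub>\<close>), so that the stochastic integral of each indicator over the simplex is the
  product of the increments.\<close>

type_synonym elementary = "(complex \<times> (nat \<Rightarrow> real) \<times> (nat \<Rightarrow> real)) list"

definition elementary :: "nat \<Rightarrow> elementary \<Rightarrow> bool" where
  "elementary k L \<longleftrightarrow> (\<forall>(c, a, b)\<in>set L.
     (\<forall>i<k. 0 \<le> a i \<and> a i < b i \<and> b i \<le> 1) \<and> (\<forall>i. Suc i < k \<longrightarrow> b i \<le> a (Suc i)))"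

definition elementary_fun :: "nat \<Rightarrow> elementary \<Rightarrow> (nat \<Rightarrow> real) \<Rightarrow> complex" where
  "elementary_fun k L s =
     (\<Sum>(c, a, b)\<leftarrow>L. c * indicator (Pi {..<k} (\<lambda>i. {a i<..b i})) s)"

definition elementary_integral :: "nat \<Rightarrow> elementary \<Rightarrow> (real \<Rightarrow> real) \<Rightarrow> complex" where
  "elementary_integral k L \<omega> =
     (\<Sum>(c, a, b)\<leftarrow>L. c * complex_of_real (\<Prod>i<k. \<omega> (b i) - \<omega> (a i)))"

text \<open>\<open>wiener_integral M k f X\<close>: \<open>X\<close> is a version of
  \<open>\<integral>\<^bsub>s\<^sub>1 < \<dots> < s\<^sub>k\<^esub> f(s\<^sub>1,\<dots>,s\<^sub>k) dB\<^bsub>s\<^sub>1\<^esub> \<dots> dB\<^bsub>s\<^sub>k\<^esub>\<close>, obtained by \<open>L\<^sup>2\<close>-closure from elementary integrands.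
  For \<open>k = 0\<close> the base space is a single point of mass 1 and \<open>X\<close> is an a.e. constant.\<close>

definition wiener_integral ::
    "(real \<Rightarrow> real) measure \<Rightarrow> nat \<Rightarrow> ((nat \<Rightarrow> real) \<Rightarrow> complex) \<Rightarrow> ((real \<Rightarrow> real) \<Rightarrow> complex) \<Rightarrow> bool" where
  "wiener_integral M k f X \<longleftrightarrow>
     (\<exists>L :: nat \<Rightarrow> elementary. (\<forall>N. elementary k (L N)) \<and>
        L2_tendsto (simplex_measure k) (\<lambda>N. elementary_fun k (L N)) f \<and>
        L2_tendsto M (\<lambda>N. elementary_integral k (L N)) X)"

definition wiener_chaos :: "(real \<Rightarrow> real) measure \<Rightarrow> nat \<Rightarrow> ((real \<Rightarrow> real) \<Rightarrow> complex) set" where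
  "wiener_chaos M k = {X. \<exists>f\<in>L2_sym k. wiener_integral M k f X}"

definition phase_isometry ::
    "(real \<Rightarrow> real) measure \<Rightarrow> (real \<Rightarrow> real) \<Rightarrow> nat \<Rightarrow>
     (((real \<Rightarrow> real) \<Rightarrow> complex) \<Rightarrow> ((real \<Rightarrow> real) \<Rightarrow> complex)) \<Rightarrow> bool" where
  "phase_isometry M \<theta> n R \<longleftrightarrow>
     L2_linear_isometry M R \<and>
     (\<forall>c. AE \<omega> in M. R (\<lambda>_. c) \<omega> = c) \<and>
     (\<forall>k\<ge>1. \<forall>f\<in>L2_sym k. \<forall>X. wiener_integral M k f X \<longrightarrow>
        wiener_integral M k
          (\<lambda>s. f s * (\<Prod>j<k. exp (\<i> / of_nat n * complex_of_real (\<theta> (real n * s j))))) (R X))"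

text \<open>The Ornstein-Uhlenbeck operator on its maximal domain: the graph consists of the pairs
  \<open>(\<Sum>\<^sub>k Z\<^sub>k, \<Sum>\<^sub>k -(k/2) Z\<^sub>k)\<close> with \<open>Z\<^sub>k\<close> in the \<open>k\<close>-th chaos and both series convergent in \<open>L\<^sup>2\<close>.\<close>

definition OU_graph ::
    "(real \<Rightarrow> real) measure \<Rightarrow> ((real \<Rightarrow> real) \<Rightarrow> complex) \<Rightarrow> ((real \<Rightarrow> real) \<Rightarrow> complex) \<Rightarrow> bool" where
  "OU_graph M X Y \<longleftrightarrow>
     (\<exists>Z. (\<forall>k. Z k \<in> wiener_chaos M k) \<and>
        L2_tendsto M (\<lambda>K \<omega>. \<Sum>k<K. Z k \<omega>) X \<and>
        L2_tendsto M (\<lambda>K \<omega>. \<Sum>k<K. - (of_nat k / 2) * Z k \<omega>) Y)"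

definition OU_domain :: "(real \<Rightarrow> real) measure \<Rightarrow> ((real \<Rightarrow> real) \<Rightarrow> complex) set" where
  "OU_domain M = {X. \<exists>Y. OU_graph M X Y}"

text \<open>The value is determined almost everywhere.\<close>

definition OU :: "(real \<Rightarrow> real) measure \<Rightarrow> ((real \<Rightarrow> real) \<Rightarrow> complex) \<Rightarrow> (real \<Rightarrow> real) \<Rightarrow> complex" where
  "OU M X = (SOME Y. OU_graph M X Y)"

definition OU_dirichlet_form :: "(real \<Rightarrow> real) measure \<Rightarrow> ((real \<Rightarrow> real) \<Rightarrow> complex) \<Rightarrow> complex" where
  "OU_dirichlet_form M X = - (LINT \<omega>|M. cnj (X \<omega>) * OU M X \<omega>)"

end

theory Submission
  imports Defs
begin

text \<open>
  Write \<open>X = \<Sum>\<^sub>k Z\<^sub>k\<close> with \<open>Z\<^sub>k\<close> in the \<open>k\<close>-th chaos and kernel \<open>f\<^sub>k\<close>. Since \<open>R\<^sub>n\<close> preserves the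
  chaoses, the Ito isometry gives \<open>n\<^sup>2 \<parallel>R\<^sub>n X - X\<parallel>\<^sup>2 = \<Sum>\<^sub>k \<integral> \<bar>f\<^sub>k\<bar>\<^sup>2 n\<^sup>2 \<bar>e\<^bsup>iu/n\<^esup> - 1\<bar>\<^sup>2\<close> with
  \<open>u(s) = \<Sum>\<^sub>j \<theta>(n s\<^sub>j)\<close>. Up to \<open>O(1/n)\<close> the last factor is \<open>u\<^sup>2\<close>, and by periodic averaging on boxes
  \<open>u\<^sup>2\<close> converges weakly to \<open>k\<close>, so that the \<open>k\<close>-th term tends to \<open>k \<parallel>Z\<^sub>k\<parallel>\<^sup>2\<close>. The \<open>k\<close>-th term is at
  most \<open>k\<^sup>2 (sup \<bar>\<theta>\<bar>)\<^sup>2 \<parallel>Z\<^sub>k\<parallel>\<^sup>2\<close>, which is summable precisely because \<open>X\<close> lies in the domain of the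
  Ornstein-Uhlenbeck operator, and Tannery's theorem allows one to pass to the limit under the sum.
\<close>

section \<open>The space of square integrable functions\<close>

text \<open>The square of u in general has no pointwise limit; only its averages over fixed boxes
  settle down. In the double sum of \<theta>(n s_i) \<theta>(n s_j) the off-diagonal terms average
  to 0 because \<theta> has mean zero, and each of the k diagonal terms averages to 1 because
  \<theta>^2 has mean one; this is the origin of the factor k. Kernels are reached from step
  functions with an error uniform in n, since |u| is at most k sup |\<theta>|, and the approximating
  step functions are supplied by \<open>wiener_integral\<close> itself. The Ito isometry is
  established for inner products, because it has to deliver the orthogonality of the increments R_n
  Z_k - Z_k across chaoses as well as their norms. R_n acts on representatives, is linear up to null
  sets, and is described through kernels for k >= 1 and n >= 1. Identities for it are therefore read
  under the norm, constants are handled by approximation, and the index n = 0 is kept apart.\<close>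

definition L2_norm :: "'a measure \<Rightarrow> ('a \<Rightarrow> complex) \<Rightarrow> real" where
  "L2_norm M X = sqrt (LINT \<omega>|M. (cmod (X \<omega>))\<^sup>2)"

text \<open>Linear in the first argument, conjugate linear in the second. The conjugate in the
  Dirichlet form falls on \<open>X\<close>, so that form is minus
  \<open>L2_inner M (OU M X) X\<close>.\<close>

definition L2_inner :: "'a measure \<Rightarrow> ('a \<Rightarrow> complex) \<Rightarrow> ('a \<Rightarrow> complex) \<Rightarrow> complex" where
  "L2_inner M X Y = (LINT \<omega>|M. X \<omega> * cnj (Y \<omega>))"

lemma L2_norm_nonneg [simp]: "L2_norm M X \<ge> 0"
  by (simp add: L2_norm_def)

lemma L2_norm_power2: "(L2_norm M X)\<^sup>2 = (LINT \<omega>|M. (cmod (X \<omega>))\<^sup>2)"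
  by (simp add: L2_norm_def)

lemma L2_measurable: "X \<in> L2 M \<Longrightarrow> X \<in> borel_measurable M"
  and L2_integrable: "X \<in> L2 M \<Longrightarrow> integrable M (\<lambda>\<omega>. (cmod (X \<omega>))\<^sup>2)"
  by (auto simp: L2_def)

lemma L2_inner_self: "L2_inner M X X = of_real ((L2_norm M X)\<^sup>2)"
  unfolding L2_inner_def L2_norm_power2 complex_norm_square[symmetric]
  by (subst integral_complex_of_real[symmetric]) simp

lemma L2_integrable_cmod_mult:
  assumes X: "X \<in> L2 M" and Y: "Y \<in> L2 M"
  shows "integrable M (\<lambda>\<omega>. cmod (X \<omega>) * cmod (Y \<omega>))"
proof (rule Bochner_Integration.integrable_bound)
  show "integrable M (\<lambda>\<omega>. (cmod (X \<omega>))\<^sup>2 + (cmod (Y \<omega>))\<^sup>2)"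
    using X Y by (intro Bochner_Integration.integrable_add L2_integrable)
  show "(\<lambda>\<omega>. cmod (X \<omega>) * cmod (Y \<omega>)) \<in> borel_measurable M"
    using X Y by (auto dest!: L2_measurable)
  have "u * v \<le> u\<^sup>2 + v\<^sup>2" for u v :: real
  proof -
    have "2 * \<bar>u * v\<bar> \<le> u\<^sup>2 + v\<^sup>2"
      using sum_squares_bound[of "\<bar>u\<bar>" "\<bar>v\<bar>"] by (simp add: abs_mult mult.assoc)
    then show ?thesis by linarith
  qed
  then show "AE \<omega> in M. norm (cmod (X \<omega>) * cmod (Y \<omega>)) \<le> norm ((cmod (X \<omega>))\<^sup>2 + (cmod (Y \<omega>))\<^sup>2)"
    by simp
qed

lemma L2_integrable_mult_cnj:
  assumes X: "X \<in> L2 M" and Y: "Y \<in> L2 M"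
  shows "integrable M (\<lambda>\<omega>. X \<omega> * cnj (Y \<omega>))"
proof (rule Bochner_Integration.integrable_bound[OF L2_integrable_cmod_mult[OF X Y]])
  have "cnj \<in> borel_measurable borel"
    by (intro borel_measurable_continuous_onI continuous_intros)
  then show "(\<lambda>\<omega>. X \<omega> * cnj (Y \<omega>)) \<in> borel_measurable M"
    using L2_measurable[OF X] L2_measurable[OF Y] by measurable
qed (simp add: norm_mult)

lemma L2_lincomb:
  assumes X: "X \<in> L2 M" and Y: "Y \<in> L2 M"
  shows "(\<lambda>\<omega>. a * X \<omega> + b * Y \<omega>) \<in> L2 M"
proof -
  have "integrable M (\<lambda>\<omega>. (cmod (a * X \<omega> + b * Y \<omega>))\<^sup>2)"
  proof (rule Bochner_Integration.integrable_bound)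
    show "integrable M (\<lambda>\<omega>. (cmod a)\<^sup>2 * (cmod (X \<omega>))\<^sup>2 + (cmod b)\<^sup>2 * (cmod (Y \<omega>))\<^sup>2
        + 2 * cmod a * cmod b * (cmod (X \<omega>) * cmod (Y \<omega>)))"
      using X Y
      by (intro Bochner_Integration.integrable_add integrable_mult_right L2_integrable
          L2_integrable_cmod_mult)
    show "(\<lambda>\<omega>. (cmod (a * X \<omega> + b * Y \<omega>))\<^sup>2) \<in> borel_measurable M"
      using X Y by (auto dest!: L2_measurable)
    have "(cmod (a * x + b * y))\<^sup>2 \<le> (cmod a)\<^sup>2 * (cmod x)\<^sup>2 + (cmod b)\<^sup>2 * (cmod y)\<^sup>2
        + 2 * cmod a * cmod b * (cmod x * cmod y)" for x y
    proof -
      have "(cmod (a * x + b * y))\<^sup>2 \<le> (cmod a * cmod x + cmod b * cmod y)\<^sup>2"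
        by (intro power_mono) (auto intro: order_trans[OF norm_triangle_ineq] simp: norm_mult)
      then show ?thesis
        by (simp add: power2_sum power_mult_distrib mult_ac)
    qed
    then show "AE \<omega> in M. norm ((cmod (a * X \<omega> + b * Y \<omega>))\<^sup>2) \<le>
        norm ((cmod a)\<^sup>2 * (cmod (X \<omega>))\<^sup>2 + (cmod b)\<^sup>2 * (cmod (Y \<omega>))\<^sup>2
          + 2 * cmod a * cmod b * (cmod (X \<omega>) * cmod (Y \<omega>)))"
      by (intro AE_I2) simp
  qed
  then show ?thesis
    using X Y by (auto simp: L2_def)
qed

lemma L2_diff: "X \<in> L2 M \<Longrightarrow> Y \<in> L2 M \<Longrightarrow> (\<lambda>\<omega>. X \<omega> - Y \<omega>) \<in> L2 M"
  using L2_lincomb[of X M Y 1 "-1"] by simp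

lemma L2_sum:
  assumes "finite A" "\<And>k. k \<in> A \<Longrightarrow> Z k \<in> L2 M"
  shows "(\<lambda>\<omega>. \<Sum>k\<in>A. Z k \<omega>) \<in> L2 M"
  using assms
proof (induction rule: finite_induct)
  case empty
  then show ?case by (simp add: L2_def)
next
  case (insert k A)
  then show ?case
    using L2_lincomb[of "Z k" M "\<lambda>\<omega>. \<Sum>k\<in>A. Z k \<omega>" 1 1] by simp
qed

lemma L2_inner_lincomb_left:
  assumes "X \<in> L2 M" "Y \<in> L2 M" "Z \<in> L2 M"
  shows "L2_inner M (\<lambda>\<omega>. a * X \<omega> + b * Y \<omega>) Z = a * L2_inner M X Z + b * L2_inner M Y Z"
  using L2_integrable_mult_cnj[of X M Z] L2_integrable_mult_cnj[of Y M Z] assms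
  by (simp add: L2_inner_def distrib_right mult.assoc)

lemma L2_inner_lincomb_right:
  assumes "X \<in> L2 M" "Y \<in> L2 M" "Z \<in> L2 M"
  shows "L2_inner M Z (\<lambda>\<omega>. a * X \<omega> + b * Y \<omega>) = cnj a * L2_inner M Z X + cnj b * L2_inner M Z Y"
  using L2_integrable_mult_cnj[of Z M X] L2_integrable_mult_cnj[of Z M Y] assms
  by (simp add: L2_inner_def distrib_left mult.left_commute)

text \<open>The quadratic polynomial t -> integral of (t|X| - |Y|)^2 is nonnegative, so its
  discriminant is not positive. The moduli stay inside the integral because
  \<open>L2_tendsto_integral_abs\<close> needs the bound for the product of moduli, not just for the
  inner product.\<close>

lemma L2_Cauchy_Schwarz:
  assumes X: "X \<in> L2 M" and Y: "Y \<in> L2 M"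
  shows "(LINT \<omega>|M. cmod (X \<omega>) * cmod (Y \<omega>)) \<le> L2_norm M X * L2_norm M Y"
proof -
  define P where "P = (LINT \<omega>|M. cmod (X \<omega>) * cmod (Y \<omega>))"
  define A where "A = (LINT \<omega>|M. (cmod (X \<omega>))\<^sup>2)"
  define B where "B = (LINT \<omega>|M. (cmod (Y \<omega>))\<^sup>2)"
  have quad: "0 \<le> t\<^sup>2 * A - 2 * t * P + B" for t
  proof -
    have "0 \<le> (LINT \<omega>|M. (t * cmod (X \<omega>) - cmod (Y \<omega>))\<^sup>2)"
      by simp
    also have "\<dots> = (LINT \<omega>|M. t\<^sup>2 * (cmod (X \<omega>))\<^sup>2 - 2 * t * (cmod (X \<omega>) * cmod (Y \<omega>))
        + (cmod (Y \<omega>))\<^sup>2)"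
      by (simp add: power2_diff power_mult_distrib algebra_simps)
    also have "\<dots> = t\<^sup>2 * A - 2 * t * P + B"
      using L2_integrable[OF X] L2_integrable[OF Y] L2_integrable_cmod_mult[OF X Y]
      by (simp add: A_def B_def P_def)
    finally show ?thesis .
  qed
  have "0 \<le> A" "0 \<le> B" "0 \<le> P"
    by (auto simp: A_def B_def P_def)
  have "P\<^sup>2 \<le> A * B"
  proof (cases "A = 0")
    case True
    have "P = 0"
    proof (rule ccontr)
      assume "P \<noteq> 0"
      \<comment> \<open>With A = 0 the polynomial is affine in t, and at this t it takes the value
        -1.\<close>
      then show False
        using quad[of "(B + 1) / (2 * P)"] True by simp
    qed
    then show ?thesis
      using True by simp
  next
    case False
    \<comment> \<open>The minimiser of the polynomial is t = P / A.\<close>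
    have "0 \<le> A * ((P / A)\<^sup>2 * A - 2 * (P / A) * P + B)"
      using quad[of "P / A"] \<open>0 \<le> A\<close> by simp
    also have "\<dots> = A * B - P\<^sup>2"
      using False by (simp add: field_simps power2_eq_square)
    finally show ?thesis by simp
  qed
  then have "P \<le> sqrt (A * B)"
    using real_le_rsqrt by blast
  then show ?thesis
    by (simp add: P_def A_def B_def L2_norm_def real_sqrt_mult)
qed

lemma L2_inner_bound:
  assumes X: "X \<in> L2 M" and Y: "Y \<in> L2 M"
  shows "cmod (L2_inner M X Y) \<le> L2_norm M X * L2_norm M Y"
proof -
  have "cmod (L2_inner M X Y) \<le> (LINT \<omega>|M. cmod (X \<omega> * cnj (Y \<omega>)))"
    unfolding L2_inner_def by (rule integral_norm_bound)
  then show ?thesis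
    using L2_Cauchy_Schwarz[OF X Y] by (simp add: norm_mult)
qed

section \<open>Mean square convergence and its effect on norms and inner products\<close>

lemma L2_tendsto_iff:
  "L2_tendsto M Xs X \<longleftrightarrow>
    (\<forall>N. Xs N \<in> L2 M) \<and> X \<in> L2 M \<and> (\<lambda>N. L2_norm M (\<lambda>\<omega>. Xs N \<omega> - X \<omega>)) \<longlonglongrightarrow> 0"
proof -
  have "(\<lambda>N. L2_norm M (\<lambda>\<omega>. Xs N \<omega> - X \<omega>)) \<longlonglongrightarrow> 0 \<longleftrightarrow>
      (\<lambda>N. LINT \<omega>|M. (cmod (Xs N \<omega> - X \<omega>))\<^sup>2) \<longlonglongrightarrow> 0"
    (is "?n \<longlonglongrightarrow> 0 \<longleftrightarrow> ?s \<longlonglongrightarrow> 0")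
  proof
    assume "?n \<longlonglongrightarrow> 0"
    then have "(\<lambda>N. (?n N)\<^sup>2) \<longlonglongrightarrow> 0\<^sup>2"
      by (rule tendsto_power)
    then show "?s \<longlonglongrightarrow> 0"
      by (simp add: L2_norm_power2)
  next
    assume "?s \<longlonglongrightarrow> 0"
    then have "(\<lambda>N. sqrt (?s N)) \<longlonglongrightarrow> sqrt 0"
      by (rule tendsto_real_sqrt)
    then show "?n \<longlonglongrightarrow> 0"
      by (simp add: L2_norm_def)
  qed
  then show ?thesis
    by (simp add: L2_tendsto_def)
qed

lemma L2_tendstoD:
  assumes "L2_tendsto M Xs X"
  shows "Xs N \<in> L2 M" "X \<in> L2 M" "(\<lambda>N. L2_norm M (\<lambda>\<omega>. Xs N \<omega> - X \<omega>)) \<longlonglongrightarrow> 0"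
  using assms by (auto simp: L2_tendsto_iff)

text \<open>With U = Xs - X and V = Ys - Y, the difference of the inner products is <U,V> + <U,Y> +
  <X,V>, and each term is small by Cauchy-Schwarz. This carries the Ito isometry from elementary
  integrands to their closure.\<close>

lemma L2_tendsto_inner:
  assumes X: "L2_tendsto M Xs X" and Y: "L2_tendsto M Ys Y"
  shows "(\<lambda>N. L2_inner M (Xs N) (Ys N)) \<longlonglongrightarrow> L2_inner M X Y"
proof -
  note X' = L2_tendstoD[OF X] and Y' = L2_tendstoD[OF Y]
  let ?U = "\<lambda>N \<omega>. Xs N \<omega> - X \<omega>" and ?V = "\<lambda>N \<omega>. Ys N \<omega> - Y \<omega>"
  have U: "?U N \<in> L2 M" and V: "?V N \<in> L2 M" for N
    using X' Y' by (auto intro: L2_diff)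
  have eq: "L2_inner M (Xs N) (Ys N) - L2_inner M X Y =
      L2_inner M (?U N) (?V N) + L2_inner M (?U N) Y + L2_inner M X (?V N)" for N
    using L2_inner_lincomb_left[OF X'(1)[of N] X'(2) V[of N], of 1 "-1"]
      L2_inner_lincomb_left[OF X'(1)[of N] X'(2) Y'(2), of 1 "-1"]
      L2_inner_lincomb_right[OF Y'(1)[of N] Y'(2) X'(1)[of N], of 1 "-1"]
      L2_inner_lincomb_right[OF Y'(1)[of N] Y'(2) X'(2), of 1 "-1"]
    by simp
  have "(\<lambda>N. L2_norm M (?U N) * L2_norm M (?V N) + L2_norm M (?U N) * L2_norm M Y
      + L2_norm M X * L2_norm M (?V N)) \<longlonglongrightarrow> 0"
    using tendsto_add[OF tendsto_add[OF tendsto_mult[OF X'(3) Y'(3)]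
        tendsto_mult_right[OF X'(3), of "L2_norm M Y"]] tendsto_mult_left[OF Y'(3), of "L2_norm M X"]]
    by simp
  moreover have "cmod (L2_inner M (Xs N) (Ys N) - L2_inner M X Y) \<le>
      L2_norm M (?U N) * L2_norm M (?V N) + L2_norm M (?U N) * L2_norm M Y
      + L2_norm M X * L2_norm M (?V N)" for N
    unfolding eq
    by (intro order_trans[OF norm_triangle_ineq] add_mono L2_inner_bound U V X' Y')
  ultimately have "(\<lambda>N. L2_inner M (Xs N) (Ys N) - L2_inner M X Y) \<longlonglongrightarrow> 0"
    by (rule Lim_null_comparison[OF always_eventually[OF allI], rotated])
  then show ?thesis
    by (rule LIM_zero_cancel)
qed

lemma L2_tendsto_norm:
  assumes "L2_tendsto M Xs X"
  shows "(\<lambda>N. (L2_norm M (Xs N))\<^sup>2) \<longlonglongrightarrow> (L2_norm M X)\<^sup>2"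
  using L2_tendsto_inner[OF assms assms] unfolding L2_inner_self tendsto_of_real_iff .

lemma L2_norm_cong_AE:
  assumes "X \<in> L2 M" "Y \<in> L2 M" "AE \<omega> in M. X \<omega> = Y \<omega>"
  shows "L2_norm M X = L2_norm M Y"
  unfolding L2_norm_def
  using assms by (auto intro!: integral_cong_AE dest!: L2_measurable)

text \<open>Expand the first copy of Z in <Z,Z> linearly, estimate each term by Cauchy-Schwarz, and
  divide by the norm of Z unless it vanishes.\<close>

lemma L2_norm_lincomb_le:
  assumes X: "X \<in> L2 M" and Y: "Y \<in> L2 M"
  shows "L2_norm M (\<lambda>\<omega>. a * X \<omega> + b * Y \<omega>) \<le> cmod a * L2_norm M X + cmod b * L2_norm M Y"
proof -
  let ?Z = "\<lambda>\<omega>. a * X \<omega> + b * Y \<omega>"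
  have Z: "?Z \<in> L2 M" by (intro L2_lincomb X Y)
  have "(L2_norm M ?Z)\<^sup>2 = cmod (L2_inner M ?Z ?Z)"
    by (simp add: L2_inner_self norm_power)
  also have "\<dots> = cmod (a * L2_inner M X ?Z + b * L2_inner M Y ?Z)"
    by (subst L2_inner_lincomb_left[OF X Y Z]) simp
  also have "\<dots> \<le> cmod a * cmod (L2_inner M X ?Z) + cmod b * cmod (L2_inner M Y ?Z)"
    by (rule order_trans[OF norm_triangle_ineq]) (simp add: norm_mult)
  also have "\<dots> \<le> cmod a * (L2_norm M X * L2_norm M ?Z) + cmod b * (L2_norm M Y * L2_norm M ?Z)"
    by (intro add_mono mult_left_mono L2_inner_bound X Y Z) auto
  also have "\<dots> = (cmod a * L2_norm M X + cmod b * L2_norm M Y) * L2_norm M ?Z"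
    by (simp add: algebra_simps)
  finally show ?thesis
    using L2_norm_nonneg[of M ?Z] by (cases "L2_norm M ?Z = 0")
      (auto simp: power2_eq_square mult_le_cancel_right less_le)
qed

lemma L2_tendsto_lincomb:
  assumes X: "L2_tendsto M Xs X" and Y: "L2_tendsto M Ys Y"
  shows "L2_tendsto M (\<lambda>N \<omega>. a * Xs N \<omega> + b * Ys N \<omega>) (\<lambda>\<omega>. a * X \<omega> + b * Y \<omega>)"
proof -
  note X' = L2_tendstoD[OF X] and Y' = L2_tendstoD[OF Y]
  have "(\<lambda>N. cmod a * L2_norm M (\<lambda>\<omega>. Xs N \<omega> - X \<omega>) + cmod b * L2_norm M (\<lambda>\<omega>. Ys N \<omega> - Y \<omega>))
      \<longlonglongrightarrow> 0"
    using tendsto_add[OF tendsto_mult_left[OF X'(3), of "cmod a"] tendsto_mult_left[OF Y'(3), of "cmod b"]]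
    by simp
  moreover have "norm (L2_norm M (\<lambda>\<omega>. a * (Xs N \<omega> - X \<omega>) + b * (Ys N \<omega> - Y \<omega>))) \<le>
      cmod a * L2_norm M (\<lambda>\<omega>. Xs N \<omega> - X \<omega>) + cmod b * L2_norm M (\<lambda>\<omega>. Ys N \<omega> - Y \<omega>)" for N
    using L2_norm_lincomb_le[OF L2_diff[OF X'(1)[of N] X'(2)] L2_diff[OF Y'(1)[of N] Y'(2)]]
    by simp
  ultimately have "(\<lambda>N. L2_norm M (\<lambda>\<omega>. a * (Xs N \<omega> - X \<omega>) + b * (Ys N \<omega> - Y \<omega>))) \<longlonglongrightarrow> 0"
    by (rule Lim_null_comparison[OF always_eventually[OF allI], rotated])
  moreover have "a * (x - y) + b * (z - w) = a * x + b * z - (a * y + b * w)" for x y z w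
    by (simp add: algebra_simps)
  ultimately show ?thesis
    unfolding L2_tendsto_iff using X' Y' by (simp add: L2_lincomb)
qed

text \<open>Two coefficient families are allowed, since the Dirichlet form pairs the weights -k/2 of
  A X with the weights 1 of X; equal families give the norms of partial sums.\<close>

lemma L2_pythagoras:
  fixes Z :: "nat \<Rightarrow> 'a \<Rightarrow> complex"
  assumes Z: "\<And>k. Z k \<in> L2 M" and orth: "\<And>k l. k \<noteq> l \<Longrightarrow> L2_inner M (Z k) (Z l) = 0"
  shows "L2_inner M (\<lambda>\<omega>. \<Sum>k<K. c k * Z k \<omega>) (\<lambda>\<omega>. \<Sum>k<K. d k * Z k \<omega>) =
    (\<Sum>k<K. c k * cnj (d k) * (L2_norm M (Z k))\<^sup>2)"
proof -
  have "L2_inner M (\<lambda>\<omega>. \<Sum>k<K. c k * Z k \<omega>) (\<lambda>\<omega>. \<Sum>k<K. d k * Z k \<omega>) =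
      (LINT \<omega>|M. (\<Sum>k<K. \<Sum>l<K. c k * cnj (d l) * (Z k \<omega> * cnj (Z l \<omega>))))"
    unfolding L2_inner_def cnj_sum sum_product by (simp add: mult_ac)
  also have "\<dots> = (\<Sum>k<K. \<Sum>l<K. c k * cnj (d l) * L2_inner M (Z k) (Z l))"
    unfolding L2_inner_def
    using L2_integrable_mult_cnj[OF Z Z]
    by (simp add: Bochner_Integration.integral_sum integrable_mult_right)
  also have "\<dots> = (\<Sum>k<K. \<Sum>l<K. if l = k then c k * cnj (d k) * (L2_norm M (Z k))\<^sup>2 else 0)"
    using orth by (intro sum.cong refl) (auto simp: L2_inner_self)
  also have "\<dots> = (\<Sum>k<K. c k * cnj (d k) * (L2_norm M (Z k))\<^sup>2)"
    by simp
  finally show ?thesis .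
qed

text \<open>From | |u|^2 - |v|^2 | <= |u - v| (|u - v| + 2 |v|) and Cauchy-Schwarz. Convergence of
  the squared moduli in L1 is what survives integration against weights bounded uniformly in
  n.\<close>

lemma L2_tendsto_integral_abs:
  assumes X: "L2_tendsto M Xs X"
  shows "(\<lambda>N. LINT \<omega>|M. \<bar>(cmod (Xs N \<omega>))\<^sup>2 - (cmod (X \<omega>))\<^sup>2\<bar>) \<longlonglongrightarrow> 0"
proof -
  note X' = L2_tendstoD[OF X]
  let ?U = "\<lambda>N \<omega>. Xs N \<omega> - X \<omega>"
  have U: "?U N \<in> L2 M" for N
    using X' by (auto intro: L2_diff)
  have pw: "\<bar>(cmod u)\<^sup>2 - (cmod v)\<^sup>2\<bar> \<le> (cmod (u - v))\<^sup>2 + 2 * (cmod v * cmod (u - v))" for u v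
  proof -
    have "\<bar>(cmod u)\<^sup>2 - (cmod v)\<^sup>2\<bar> = \<bar>cmod u - cmod v\<bar> * (cmod u + cmod v)"
      by (simp add: power2_eq_square square_diff_square_factored abs_mult mult.commute)
    also have "\<dots> \<le> cmod (u - v) * (cmod (u - v) + 2 * cmod v)"
      using norm_triangle_ineq3[of u v] norm_triangle_ineq2[of u v]
      by (intro mult_mono) auto
    finally show ?thesis by (simp add: algebra_simps power2_eq_square)
  qed
  have bd: "(LINT \<omega>|M. \<bar>(cmod (Xs N \<omega>))\<^sup>2 - (cmod (X \<omega>))\<^sup>2\<bar>)
      \<le> (L2_norm M (?U N))\<^sup>2 + 2 * (L2_norm M X * L2_norm M (?U N))" for N
  proof -
    have "(LINT \<omega>|M. \<bar>(cmod (Xs N \<omega>))\<^sup>2 - (cmod (X \<omega>))\<^sup>2\<bar>) \<le>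
        (LINT \<omega>|M. (cmod (?U N \<omega>))\<^sup>2 + 2 * (cmod (X \<omega>) * cmod (?U N \<omega>)))"
      by (rule integral_mono[OF _ _ pw])
        (intro integrable_abs Bochner_Integration.integrable_diff Bochner_Integration.integrable_add
          integrable_mult_right L2_integrable L2_integrable_cmod_mult X' U)+
    also have "\<dots> = (L2_norm M (?U N))\<^sup>2 + 2 * (LINT \<omega>|M. cmod (X \<omega>) * cmod (?U N \<omega>))"
      unfolding L2_norm_power2
      by (subst Bochner_Integration.integral_add)
        (simp_all add: integrable_mult_right L2_integrable[OF U] L2_integrable_cmod_mult[OF X'(2) U])
    finally show ?thesis
      using L2_Cauchy_Schwarz[OF X'(2) U[of N]] by linarith
  qed
  have "(\<lambda>N. (L2_norm M (?U N))\<^sup>2 + 2 * (L2_norm M X * L2_norm M (?U N))) \<longlonglongrightarrow> 0"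
    using tendsto_add[OF tendsto_power[OF X'(3), of 2]
        tendsto_mult_left[OF tendsto_mult_left[OF X'(3), of "L2_norm M X"], of 2]]
    by simp
  moreover have "norm (LINT \<omega>|M. \<bar>(cmod (Xs N \<omega>))\<^sup>2 - (cmod (X \<omega>))\<^sup>2\<bar>)
      \<le> (L2_norm M (?U N))\<^sup>2 + 2 * (L2_norm M X * L2_norm M (?U N))" for N
    using bd[of N] by simp
  ultimately show ?thesis
    by (rule Lim_null_comparison[OF always_eventually[OF allI], rotated])
qed

section \<open>Elementary integrands on the simplex\<close>

lemma sum_list_eq_sum_nth: "(\<Sum>x\<leftarrow>xs. f x) = (\<Sum>i<length xs. f (xs ! i))"
  by (simp add: sum_list_sum_nth atLeast0LessThan)

text \<open>Serves both sides of the Ito isometry: the entries of the list become indicators on the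
  simplex or increment products on path space, and \<open>w\<close> carries the oscillating weight.
  The sums are indexed by list positions because an entry may be repeated.\<close>

lemma integral_sum_list_mult:
  fixes F G :: "'b \<Rightarrow> 'a \<Rightarrow> real" and w :: "'a \<Rightarrow> real"
  assumes int: "\<And>x y. x \<in> set L \<Longrightarrow> y \<in> set L' \<Longrightarrow>
    integrable M (\<lambda>\<omega>. F (snd x) \<omega> * G (snd y) \<omega> * w \<omega>)"
  shows "(LINT \<omega>|M. (\<Sum>x\<leftarrow>L. fst x * complex_of_real (F (snd x) \<omega>)) *
      cnj (\<Sum>y\<leftarrow>L'. fst y * complex_of_real (G (snd y) \<omega>)) * complex_of_real (w \<omega>)) =
    (\<Sum>x\<leftarrow>L. \<Sum>y\<leftarrow>L'. fst x * cnj (fst y) *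
      complex_of_real (LINT \<omega>|M. F (snd x) \<omega> * G (snd y) \<omega> * w \<omega>))"
proof -
  define T where "T i j \<omega> = fst (L ! i) * cnj (fst (L' ! j)) *
      complex_of_real (F (snd (L ! i)) \<omega> * G (snd (L' ! j)) \<omega> * w \<omega>)" for i j \<omega>
  have T: "integrable M (T i j)" if "i < length L" "j < length L'" for i j
    unfolding T_def using int[of "L ! i" "L' ! j"] that
    by (intro integrable_mult_right integrable_of_real) simp
  have "(LINT \<omega>|M. (\<Sum>x\<leftarrow>L. fst x * complex_of_real (F (snd x) \<omega>)) *
      cnj (\<Sum>y\<leftarrow>L'. fst y * complex_of_real (G (snd y) \<omega>)) * complex_of_real (w \<omega>)) =
      (LINT \<omega>|M. (\<Sum>i<length L. \<Sum>j<length L'. T i j \<omega>))"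
    unfolding sum_list_eq_sum_nth cnj_sum sum_product
    unfolding sum_distrib_right T_def
    by (simp add: mult_ac)
  also have "\<dots> = (\<Sum>i<length L. \<Sum>j<length L'. LINT \<omega>|M. T i j \<omega>)"
    using T by (subst Bochner_Integration.integral_sum)
      (auto intro!: sum.cong Bochner_Integration.integral_sum Bochner_Integration.integrable_sum)
  also have "\<dots> = (\<Sum>x\<leftarrow>L. \<Sum>y\<leftarrow>L'. fst x * cnj (fst y) *
      complex_of_real (LINT \<omega>|M. F (snd x) \<omega> * G (snd y) \<omega> * w \<omega>))"
    unfolding sum_list_eq_sum_nth T_def integral_complex_of_real[symmetric]
    by (intro sum.cong refl integral_mult_right_zero)
  finally show ?thesis .
qed

definition simplex_box :: "nat \<Rightarrow> (nat \<Rightarrow> real) \<Rightarrow> (nat \<Rightarrow> real) \<Rightarrow> bool" where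
  "simplex_box k a b \<longleftrightarrow>
    (\<forall>i<k. 0 \<le> a i \<and> a i < b i \<and> b i \<le> 1) \<and> (\<forall>i. Suc i < k \<longrightarrow> b i \<le> a (Suc i))"

abbreviation box_ind :: "nat \<Rightarrow> (nat \<Rightarrow> real) \<times> (nat \<Rightarrow> real) \<Rightarrow> (nat \<Rightarrow> real) \<Rightarrow> real" where
  "box_ind k p \<equiv> indicator (Pi {..<k} (\<lambda>i. {fst p i<..snd p i}))"

lemma elementary_simplex_box:
  "elementary k L \<Longrightarrow> x \<in> set L \<Longrightarrow> simplex_box k (fst (snd x)) (snd (snd x))"
  by (cases x) (fastforce simp: elementary_def simplex_box_def)

lemma elementary_fun_alt:
  "elementary_fun k L s = (\<Sum>x\<leftarrow>L. fst x * complex_of_real (box_ind k (snd x) s))"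
  by (simp add: elementary_fun_def case_prod_unfold of_real_indicator)

text \<open>Chain the consecutive inequalities; the intervals in between have positive length, so
  passing through them only moves to the right.\<close>

lemma simplex_box_le:
  assumes "simplex_box k a b" "i < j" "j < k"
  shows "b i \<le> a j"
  using assms(2,3)
proof (induction j)
  case (Suc j)
  have "a j < b j" "b j \<le> a (Suc j)"
    using assms(1) Suc.prems by (auto simp: simplex_box_def)
  then show ?case
    using Suc by (cases "i = j") auto
qed simp

lemma simplex_box_subset:
  assumes "simplex_box k a b" "s \<in> Pi {..<k} (\<lambda>i. {a i<..b i})"
  shows "\<forall>j<k. \<forall>i<j. s i < s j"
proof (intro allI impI)
  fix i j assume "j < k" "i < j"
  then have "s i \<le> b i" "b i \<le> a j" "a j < s j"
    using assms simplex_box_le by (auto simp: Pi_iff)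
  then show "s i < s j" by linarith
qed

lemma indicator_Pi: "indicator (Pi {..<k} A) s = (\<Prod>i<k::nat. indicator (A i) (s i) :: real)"
  by (induction k) (auto simp: indicator_def Pi_iff less_Suc_eq)

section \<open>Finite product measures on the cube and the simplex\<close>

abbreviation "unit_lborel \<equiv> restrict_space lborel {0..1::real}"

lemma space_unit_lborel: "space unit_lborel = {0..1}"
  by (simp add: space_restrict_space)

lemma finite_measure_unit_lborel: "finite_measure unit_lborel"
  by (rule finite_measureI) (simp add: space_unit_lborel emeasure_restrict_space)

lemma product_sigma_finite_unit_lborel: "product_sigma_finite (\<lambda>_::nat. unit_lborel)"
  using finite_measure_unit_lborel
  by (intro product_sigma_finite.intro) (simp add: finite_measure_def)

lemma finite_measure_cube: "finite_measure (cube_measure k)"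
proof -
  interpret product_sigma_finite "\<lambda>_::nat. unit_lborel"
    by (rule product_sigma_finite_unit_lborel)
  interpret U: finite_measure unit_lborel
    by (rule finite_measure_unit_lborel)
  show ?thesis
    unfolding cube_measure_def
    using emeasure_PiM[of "{..<k}" "\<lambda>_. space unit_lborel"] sets.top[of unit_lborel]
    by (intro finite_measureI) (simp add: space_PiM U.emeasure_eq_measure ennreal_power)
qed

lemma cube_coordinate_measurable [measurable]:
  "i < k \<Longrightarrow> (\<lambda>s. s i) \<in> borel_measurable (cube_measure k)"
proof -
  assume "i < k"
  then have "(\<lambda>s. s i) \<in> cube_measure k \<rightarrow>\<^sub>M unit_lborel"
    unfolding cube_measure_def by (intro measurable_component_singleton) simp
  moreover have "(\<lambda>x. x) \<in> unit_lborel \<rightarrow>\<^sub>M borel"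
    by (intro measurable_restrict_space1) simp
  ultimately show ?thesis
    by (rule measurable_compose)
qed

text \<open>A finite intersection of the open half-spaces s_i < s_j. Intersecting with the space is
  the form that integration over a restricted space asks for.\<close>

lemma simplex_measurable:
  "{s. \<forall>j<k. \<forall>i<j. s i < s j} \<inter> space (cube_measure k) \<in> sets (cube_measure k)"
proof -
  have "{s \<in> space (cube_measure k). \<forall>p\<in>{(i, j). i < j \<and> j < k}. s (fst p) < s (snd p)}
      \<in> sets (cube_measure k)"
  proof (intro sets.sets_Collect_finite_All)
    have "{(i, j). i < j \<and> j < k} \<subseteq> {..<k} \<times> {..<k}"
      by auto
    then show "finite {(i, j). i < j \<and> j < k}"
      by (rule finite_subset) simp
  next
    fix p assume "p \<in> {(i, j). i < j \<and> j < k}"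
    then show "{s \<in> space (cube_measure k). s (fst p) < s (snd p)} \<in> sets (cube_measure k)"
      by (intro borel_measurable_less cube_coordinate_measurable) auto
  qed
  also have "{s \<in> space (cube_measure k). \<forall>p\<in>{(i, j). i < j \<and> j < k}. s (fst p) < s (snd p)} =
      {s. \<forall>j<k. \<forall>i<j. s i < s j} \<inter> space (cube_measure k)"
    by auto
  finally show ?thesis .
qed

lemma finite_measure_simplex: "finite_measure (simplex_measure k)"
proof (rule finite_measureI)
  interpret finite_measure "cube_measure k"
    by (rule finite_measure_cube)
  show "emeasure (simplex_measure k) (space (simplex_measure k)) \<noteq> \<infinity>"
    using simplex_measurable[of k]
    by (simp add: simplex_measure_def space_restrict_space emeasure_restrict_space)
qed

lemma simplex_coordinate_measurable [measurable]:
  "i < k \<Longrightarrow> (\<lambda>s. s i) \<in> borel_measurable (simplex_measure k)"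
  unfolding simplex_measure_def by (intro measurable_restrict_space1 cube_coordinate_measurable)

lemma box_ind_measurable [measurable]: "box_ind k p \<in> borel_measurable (simplex_measure k)"
  unfolding indicator_Pi
  by (intro borel_measurable_prod measurable_compose[OF simplex_coordinate_measurable]) auto

lemma integrable_box_ind_mult:
  assumes "w \<in> borel_measurable (simplex_measure k)" "\<And>s. \<bar>w s\<bar> \<le> W"
  shows "integrable (simplex_measure k) (\<lambda>s. box_ind k p s * box_ind k q s * w s)"
proof -
  interpret finite_measure "simplex_measure k"
    by (rule finite_measure_simplex)
  have "\<bar>box_ind k p s * box_ind k q s * w s\<bar> \<le> W" for s
    using assms(2)[of s] by (auto simp: indicator_def)
  then show ?thesis
    using assms(1) by (intro integrable_const_bound[where B = W] borel_measurable_times box_ind_measurable) auto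
qed

text \<open>Weight 1 gives the kernel side of the Ito isometry; the weight
  \<open>(osc k \<theta> n s)\<^sup>2\<close> reduces the averaging of step functions to pairs of
  boxes.\<close>

lemma elementary_fun_gram:
  assumes "w \<in> borel_measurable (simplex_measure k)" "\<And>s. \<bar>w s\<bar> \<le> W"
  shows "(LINT s|simplex_measure k. elementary_fun k L s * cnj (elementary_fun k L' s) * complex_of_real (w s)) =
    (\<Sum>x\<leftarrow>L. \<Sum>y\<leftarrow>L'. fst x * cnj (fst y) * complex_of_real
      (LINT s|simplex_measure k. box_ind k (snd x) s * box_ind k (snd y) s * w s))"
  unfolding elementary_fun_alt
  by (rule integral_sum_list_mult, rule integrable_box_ind_mult[OF assms])

lemma integral_cube_prod:
  fixes g :: "nat \<Rightarrow> real \<Rightarrow> real"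
  assumes g: "\<And>i. i < k \<Longrightarrow> g i \<in> borel_measurable borel" and bd: "\<And>i x. \<bar>g i x\<bar> \<le> C i"
  shows "(LINT s|cube_measure k. (\<Prod>i<k. g i (s i))) = (\<Prod>i<k. LINT x|lborel. indicator {0..1} x * g i x)"
proof -
  interpret product_sigma_finite "\<lambda>_::nat. unit_lborel"
    by (rule product_sigma_finite_unit_lborel)
  interpret U: finite_measure unit_lborel
    by (rule finite_measure_unit_lborel)
  have int: "integrable unit_lborel (g i)" if "i < k" for i
    using g[OF that] bd[of i]
    by (intro U.integrable_const_bound[where B = "C i"] measurable_restrict_space1) auto
  have "(LINT s|cube_measure k. (\<Prod>i<k. g i (s i))) = (\<Prod>i<k. integral\<^sup>L unit_lborel (g i))"
    unfolding cube_measure_def using int by (intro product_integral_prod) auto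
  also have "\<dots> = (\<Prod>i<k. LINT x|lborel. indicator {0..1} x * g i x)"
    by (simp add: integral_restrict_space)
  finally show ?thesis .
qed

text \<open>The first box lies in the simplex, so its indicator absorbs the ordering constraint;
  what remains is a product function on the cube, and Fubini separates the coordinates.\<close>

lemma integral_simplex_box:
  fixes g :: "nat \<Rightarrow> real \<Rightarrow> real"
  assumes p: "simplex_box k (fst p) (snd p)"
    and g: "\<And>i. i < k \<Longrightarrow> g i \<in> borel_measurable borel" and bd: "\<And>i x. \<bar>g i x\<bar> \<le> C i"
  shows "(LINT s|simplex_measure k. box_ind k p s * box_ind k q s * (\<Prod>i<k. g i (s i))) =
    (\<Prod>i<k. LINT x|lborel. indicator ({fst p i<..snd p i} \<inter> {fst q i<..snd q i}) x * g i x)"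
proof -
  let ?I = "\<lambda>i. {fst p i<..snd p i} \<inter> {fst q i<..snd q i}"
  have bd': "\<bar>indicator (?I i) x * g i x\<bar> \<le> C i" for i x
    using bd[of i x] by (auto simp: indicator_def)
  have "(LINT s|simplex_measure k. box_ind k p s * box_ind k q s * (\<Prod>i<k. g i (s i))) =
      (LINT s|cube_measure k. indicator {s. \<forall>j<k. \<forall>i<j. s i < s j} s *
        (box_ind k p s * box_ind k q s * (\<Prod>i<k. g i (s i))))"
    unfolding simplex_measure_def by (subst integral_restrict_space[OF simplex_measurable]) simp
  also have "\<dots> = (LINT s|cube_measure k. (\<Prod>i<k. indicator (?I i) (s i) * g i (s i)))"
  proof (intro Bochner_Integration.integral_cong refl)
    fix s
    have eq: "indicator {s. \<forall>j<k. \<forall>i<j. s i < s j} s * box_ind k p s = box_ind k p s"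
      using simplex_box_subset[OF p, of s] by (auto simp: indicator_def)
    have "indicator {s. \<forall>j<k. \<forall>i<j. s i < s j} s *
        (box_ind k p s * box_ind k q s * (\<Prod>i<k. g i (s i))) =
        box_ind k p s * box_ind k q s * (\<Prod>i<k. g i (s i))"
      by (simp only: mult.assoc[symmetric] eq)
    also have "\<dots> = (\<Prod>i<k. indicator (?I i) (s i) * g i (s i))"
      unfolding indicator_Pi prod.distrib indicator_inter_arith ..
    finally show "indicator {s. \<forall>j<k. \<forall>i<j. s i < s j} s *
        (box_ind k p s * box_ind k q s * (\<Prod>i<k. g i (s i))) =
        (\<Prod>i<k. indicator (?I i) (s i) * g i (s i))" .
  qed
  also have "\<dots> = (\<Prod>i<k. LINT x|lborel. indicator {0..1} x * (indicator (?I i) x * g i x))"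
    by (intro integral_cube_prod[where C = C] borel_measurable_times g bd') auto
  also have "\<dots> = (\<Prod>i<k. LINT x|lborel. indicator (?I i) x * g i x)"
  proof (intro prod.cong refl Bochner_Integration.integral_cong)
    fix i x assume "i \<in> {..<k}"
    then show "indicator {0..1} x * (indicator (?I i) x * g i x) = indicator (?I i) x * g i x"
      using p by (fastforce simp: simplex_box_def indicator_def)
  qed
  finally show ?thesis .
qed

text \<open>The same closed form comes out of the expectation of two increment products, so the two
  sides of the isometry can be compared factor by factor. The maximum covers disjoint
  intervals.\<close>

lemma integral_indicator_Ioc_Int:
  "(LINT x|lborel. indicator ({a<..b} \<inter> {c<..d}) x) = max 0 (min b d - max a (c::real))"
proof -
  have "(LINT x|lborel. indicator ({a<..b} \<inter> {c<..d}) x) = measure lborel {max a c<..min b d}"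
    by simp
  also have "\<dots> = max 0 (min b d - max a c)"
    by (cases "max a c \<le> min b d") (simp_all only: measure_lborel_Ioc, auto)
  finally show ?thesis .
qed

section \<open>The Ito isometry\<close>

text \<open>Mean zero will remove unmatched increments, and the variance t - s will measure the
  matched ones.\<close>

lemma wiener_increment_moments:
  assumes W: "wiener_measure M" and st: "0 \<le> s" "s < t" "t \<le> 1"
  shows "integrable M (\<lambda>\<omega>. \<omega> t - \<omega> s)" "(LINT \<omega>|M. \<omega> t - \<omega> s) = 0"
    "integrable M (\<lambda>\<omega>. (\<omega> t - \<omega> s)\<^sup>2)" "(LINT \<omega>|M. (\<omega> t - \<omega> s)\<^sup>2) = t - s"
proof -
  interpret prob_space M
    using W by (simp add: wiener_measure_def)
  have D: "distributed M lborel (\<lambda>\<omega>. \<omega> t - \<omega> s) (normal_density 0 (sqrt (t - s)))"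
    using W st by (simp add: wiener_measure_def)
  have sd: "0 < sqrt (t - s)"
    using st by simp
  show "integrable M (\<lambda>\<omega>. \<omega> t - \<omega> s)"
    using integrable_normal_moment[OF sd, of 0 1] distributed_integrable[OF D, of "\<lambda>x. x"] by simp
  show "integrable M (\<lambda>\<omega>. (\<omega> t - \<omega> s)\<^sup>2)"
    using integrable_normal_moment[OF sd, of 0 2] distributed_integrable[OF D, of "\<lambda>x. x\<^sup>2"] by simp
  show E: "(LINT \<omega>|M. \<omega> t - \<omega> s) = 0"
    by (rule normal_distributed_expectation[OF sd D])
  show "(LINT \<omega>|M. (\<omega> t - \<omega> s)\<^sup>2) = t - s"
    using normal_distributed_variance[OF sd D] st by (simp only: E) simp
qed

text \<open>By independence the expectation factors over the cells: a cell in both sets contributes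
  its variance, a cell in exactly one contributes the mean 0, a cell in neither the factor 1. One
  cell in the symmetric difference thus annihilates the product.\<close>

lemma wiener_grid_product:
  assumes W: "wiener_measure M"
    and t: "\<And>i. i \<le> N \<Longrightarrow> t i \<in> {0..1}" "\<And>i. i < N \<Longrightarrow> t i < t (Suc i)"
    and S: "S \<subseteq> {..<N}" "S' \<subseteq> {..<N}"
  shows "integrable M (\<lambda>\<omega>. (\<Prod>m\<in>S. \<omega> (t (Suc m)) - \<omega> (t m)) * (\<Prod>m\<in>S'. \<omega> (t (Suc m)) - \<omega> (t m)))"
      (is "integrable M ?P")
    and "(LINT \<omega>|M. (\<Prod>m\<in>S. \<omega> (t (Suc m)) - \<omega> (t m)) * (\<Prod>m\<in>S'. \<omega> (t (Suc m)) - \<omega> (t m))) =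
      (if S = S' then \<Prod>m\<in>S. t (Suc m) - t m else 0)"
proof -
  interpret prob_space M
    using W by (simp add: wiener_measure_def)
  \<comment> \<open>Recording both memberships in one function of a single increment keeps the
    factors independent even where a square appears.\<close>
  define g :: "nat \<Rightarrow> real \<Rightarrow> real"
    where "g m x = (if m \<in> S then x else 1) * (if m \<in> S' then x else 1)" for m x
  let ?D = "\<lambda>m \<omega>. \<omega> (t (Suc m)) - \<omega> (t m) :: real"
  have sub: "(\<Prod>m\<in>A. f m) = (\<Prod>m<N. if m \<in> A then f m else 1)" if "A \<subseteq> {..<N}" for A and f :: "nat \<Rightarrow> real"
    using that by (simp add: prod.inter_restrict[symmetric] Int_absorb1)
  have P: "?P = (\<lambda>\<omega>. \<Prod>m<N. g m (?D m \<omega>))"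
    unfolding g_def prod.distrib by (simp only: sub[OF S(1), symmetric] sub[OF S(2), symmetric])
  have "indep_vars (\<lambda>_. borel) ?D {..<N}"
    using W t unfolding wiener_measure_def by blast
  then have indep: "indep_vars (\<lambda>_. borel) (\<lambda>m \<omega>. g m (?D m \<omega>)) {..<N}"
    by (rule indep_vars_compose2) (auto simp: g_def[abs_def])
  have mom: "integrable M (\<lambda>\<omega>. g m (?D m \<omega>)) \<and> (LINT \<omega>|M. g m (?D m \<omega>)) =
      (if m \<in> S then if m \<in> S' then t (Suc m) - t m else 0 else if m \<in> S' then 0 else 1)"
    if "m < N" for m
    using wiener_increment_moments[OF W, of "t m" "t (Suc m)"] t(1)[of m] t(1)[of "Suc m"] t(2)[of m] that
    by (auto simp: g_def power2_eq_square prob_space)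
  show "integrable M ?P"
    unfolding P by (rule indep_vars_integrable[OF _ indep]) (use mom in auto)
  have "(LINT \<omega>|M. ?P \<omega>) = (\<Prod>m<N. LINT \<omega>|M. g m (?D m \<omega>))"
    unfolding P by (rule indep_vars_lebesgue_integral[OF _ indep]) (use mom in auto)
  also have "\<dots> = (\<Prod>m<N. if m \<in> S then if m \<in> S' then t (Suc m) - t m else 0
      else if m \<in> S' then 0 else 1)"
    using mom by (intro prod.cong) auto
  also have "\<dots> = (if S = S' then \<Prod>m\<in>S. t (Suc m) - t m else 0)"
  proof (cases "S = S'")
    case True
    then show ?thesis
      using sub[OF S(1), of "\<lambda>m. t (Suc m) - t m"] by (auto intro: prod.cong)
  next
    case False
    then obtain m where "m < N" "(m \<in> S) \<noteq> (m \<in> S')"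
      using S by blast
    then show ?thesis
      using False by (auto intro!: prod_zero bexI[of _ m])
  qed
  finally show "(LINT \<omega>|M. ?P \<omega>) = (if S = S' then \<Prod>m\<in>S. t (Suc m) - t m else 0)" .
qed

section \<open>Refinement of boxes to a common time grid\<close>

lemma ex_common_grid:
  assumes "finite T" "T \<subseteq> {0..1::real}"
  shows "\<exists>t N. (\<forall>i\<le>N. t i \<in> {0..1::real}) \<and> (\<forall>j\<le>N. \<forall>i<j. t i < t j) \<and> (\<forall>x\<in>T. \<exists>i\<le>N::nat. x = t i)"
proof -
  \<comment> \<open>The point 0 keeps the list nonempty when T is empty, as happens later for
    chaoses of order 0, so that \<open>length xs - 1\<close> is a valid last index.\<close>
  define xs where "xs = sorted_list_of_set (insert 0 T)"
  have set: "set xs = insert 0 T" and srt: "sorted_wrt (<) xs"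
    using assms unfolding xs_def
    by (simp_all del: sorted_list_of_set_insert_remove)
  have len: "length xs > 0"
    using set by (cases xs) auto
  show ?thesis
  proof (rule exI[of _ "\<lambda>i. xs ! i"], rule exI[of _ "length xs - 1"], intro conjI allI ballI impI)
    show "xs ! i \<in> {0..1}" if "i \<le> length xs - 1" for i
    proof -
      have "i < length xs"
        using that len by linarith
      then show ?thesis
        using nth_mem[of i xs] set assms by auto
    qed
    show "xs ! i < xs ! j" if "j \<le> length xs - 1" "i < j" for i j
      using sorted_wrt_nth_less[OF srt that(2)] that len by simp
    show "\<exists>i\<le>length xs - 1. x = xs ! i" if "x \<in> T" for x
    proof -
      have "x \<in> set xs"
        using that set by simp
      then obtain i where "i < length xs" "x = xs ! i"
        by (metis in_set_conv_nth)
      then show ?thesis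
        by (intro exI[of _ i]) auto
    qed
  qed
qed

text \<open>Both enumerations list the same finite set in increasing order, and such a list is
  unique. Recovering \<open>k = l\<close> from the images is the source of the orthogonality of
  different chaoses.\<close>

lemma strict_mono_image_eq:
  fixes \<phi> \<psi> :: "nat \<Rightarrow> nat"
  assumes "\<And>i j. i < j \<Longrightarrow> j < k \<Longrightarrow> \<phi> i < \<phi> j" "\<And>i j. i < j \<Longrightarrow> j < l \<Longrightarrow> \<psi> i < \<psi> j"
    and "\<phi> ` {..<k} = \<psi> ` {..<l}"
  shows "k = l \<and> (\<forall>i<k. \<phi> i = \<psi> i)"
proof -
  have "map \<phi> [0..<k] = map \<psi> [0..<l]"
  proof -
    have "sorted_wrt (<) (map \<phi> [0..<k])" "sorted_wrt (<) (map \<psi> [0..<l])"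
      using assms(1,2) by (auto simp: sorted_wrt_iff_nth_less)
    moreover have "set (map \<phi> [0..<k]) = set (map \<psi> [0..<l])"
      using assms(3) by (simp add: atLeast0LessThan)
    ultimately show ?thesis
      unfolding strict_sorted_iff by (intro sorted_distinct_set_unique) auto
  qed
  then show ?thesis
    by (auto simp: list_eq_iff_nth_eq)
qed

text \<open>For a box inside the simplex this is the multiple Wiener integral of
  \<open>box_ind k p\<close>.\<close>

abbreviation box_inc :: "nat \<Rightarrow> (nat \<Rightarrow> real) \<times> (nat \<Rightarrow> real) \<Rightarrow> (real \<Rightarrow> real) \<Rightarrow> real" where
  "box_inc k p \<omega> \<equiv> \<Prod>i<k. \<omega> (snd p i) - \<omega> (fst p i)"

text \<open>Each factor telescopes along the grid, and expanding the product selects one cell per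
  coordinate. Since the sides of the box are ordered in time, the selected cells are strictly
  increasing, hence distinct, and the product may run over the set of cells instead of the
  coordinates.\<close>

lemma box_inc_grid:
  fixes t :: "nat \<Rightarrow> real"
  assumes grid: "\<forall>j\<le>N. \<forall>i<j. t i < t j" and box: "simplex_box k (fst p) (snd p)"
    and u: "\<forall>i<k. u i \<le> N \<and> fst p i = t (u i)" and v: "\<forall>i<k. v i \<le> N \<and> snd p i = t (v i)"
  shows "box_inc k p \<omega> = (\<Sum>\<phi>\<in>PiE {..<k} (\<lambda>i. {u i..<v i}). \<Prod>m\<in>\<phi> ` {..<k}. \<omega> (t (Suc m)) - \<omega> (t m))"
    and "\<And>\<phi> i j. \<phi> \<in> PiE {..<k} (\<lambda>i. {u i..<v i}) \<Longrightarrow> i < j \<Longrightarrow> j < k \<Longrightarrow> \<phi> i < \<phi> j"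
    and "\<And>\<phi>. \<phi> \<in> PiE {..<k} (\<lambda>i. {u i..<v i}) \<Longrightarrow> \<phi> ` {..<k} \<subseteq> {..<N}"
proof -
  have t: "t i < t j" if "i < j" "j \<le> N" for i j
    using grid that by blast
  have pq: "u i \<le> N \<and> fst p i = t (u i)" "v i \<le> N \<and> snd p i = t (v i)" if "i < k" for i
    using u v that by blast+
  have t_less: "i < j" if "t i < t j" "i \<le> N" for i j
    using t[of j i] that by (cases "i = j") (auto simp: not_less_iff_gr_or_eq intro: ccontr)
  have uv: "u i < v i" if "i < k" for i
    using pq(1)[OF that] pq(2)[OF that] box that by (intro t_less) (auto simp: simplex_box_def)
  show mono: "\<phi> i < \<phi> j" if "\<phi> \<in> PiE {..<k} (\<lambda>i. {u i..<v i})" "i < j" "j < k" for \<phi> i j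
  proof -
    have "t (v i) \<le> t (u j)"
      using simplex_box_le[OF box that(2,3)] pq(1)[of j] pq(2)[of i] that by simp
    then have "v i \<le> u j"
      using t[of "u j" "v i"] pq(2)[of i] that by (auto simp: not_le[symmetric] intro: leI)
    moreover have "\<phi> i < v i" "u j \<le> \<phi> j"
      using that by (auto simp: PiE_iff)
    ultimately show ?thesis by linarith
  qed
  show "\<phi> ` {..<k} \<subseteq> {..<N}" if "\<phi> \<in> PiE {..<k} (\<lambda>i. {u i..<v i})" for \<phi>
  proof
    fix m assume "m \<in> \<phi> ` {..<k}"
    then obtain i where "i < k" "m = \<phi> i" by auto
    then show "m \<in> {..<N}"
      using PiE_mem[OF that, of i] pq(2)[of i] by simp
  qed
  have "box_inc k p \<omega> = (\<Prod>i<k. \<Sum>m\<in>{u i..<v i}. \<omega> (t (Suc m)) - \<omega> (t m))"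
    using pq uv by (intro prod.cong refl) (simp add: sum_Suc_diff'[where f = "\<lambda>m. \<omega> (t m)"] less_imp_le)
  also have "\<dots> = (\<Sum>\<phi>\<in>PiE {..<k} (\<lambda>i. {u i..<v i}). \<Prod>i<k. \<omega> (t (Suc (\<phi> i))) - \<omega> (t (\<phi> i)))"
    by (rule prod_sum_PiE) auto
  also have "\<dots> = (\<Sum>\<phi>\<in>PiE {..<k} (\<lambda>i. {u i..<v i}). \<Prod>m\<in>\<phi> ` {..<k}. \<omega> (t (Suc m)) - \<omega> (t m))"
  proof (intro sum.cong refl)
    fix \<phi> assume "\<phi> \<in> PiE {..<k} (\<lambda>i. {u i..<v i})"
    then have "inj_on \<phi> {..<k}"
      using mono[of \<phi>] by (intro strict_mono_on_imp_inj_on[where A = "{..<k}"] strict_mono_onI) auto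
    then show "(\<Prod>i<k. \<omega> (t (Suc (\<phi> i))) - \<omega> (t (\<phi> i))) = (\<Prod>m\<in>\<phi> ` {..<k}. \<omega> (t (Suc m)) - \<omega> (t m))"
      by (simp add: prod.reindex)
  qed
  finally show "box_inc k p \<omega> = (\<Sum>\<phi>\<in>PiE {..<k} (\<lambda>i. {u i..<v i}). \<Prod>m\<in>\<phi> ` {..<k}. \<omega> (t (Suc m)) - \<omega> (t m))" .
qed

text \<open>Monotonicity of the grid commutes with minima and maxima of indices, so the sum over the
  common index range telescopes; if that range is empty, the maximum with 0 returns 0.\<close>

lemma sum_grid_Int:
  fixes t :: "nat \<Rightarrow> real"
  assumes t: "\<And>i j. i < j \<Longrightarrow> j \<le> N \<Longrightarrow> t i < t j" and "u \<le> N" "v \<le> N" "u' \<le> N" "v' \<le> N"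
  shows "(\<Sum>m\<in>{u..<v} \<inter> {u'..<v'}. t (Suc m) - t m) = max 0 (min (t v) (t v') - max (t u) (t u'))"
proof -
  have mn: "t (min i j) = min (t i) (t j)" and mx: "t (max i j) = max (t i) (t j)"
    if "i \<le> N" "j \<le> N" for i j
    using t[of i j] t[of j i] that by (cases i j rule: linorder_cases; simp)+
  have le: "t i \<le> t j" if "i \<le> j" "j \<le> N" for i j
    using t[of i j] that by (cases "i = j") auto
  have eq: "(\<Sum>m\<in>{u..<v} \<inter> {u'..<v'}. t (Suc m) - t m) = (\<Sum>m\<in>{max u u'..<min v v'}. t (Suc m) - t m)"
    by simp
  show ?thesis
  proof (cases "max u u' \<le> min v v'")
    case True
    then show ?thesis
      unfolding eq using le[OF True] assms(2-) by (simp only: sum_Suc_diff' mn mx) simp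
  next
    case False
    then have le': "min v v' \<le> max u u'"
      by linarith
    then have empty: "{max u u'..<min v v'} = {}"
      by (rule atLeastLessThan_empty)
    show ?thesis
      unfolding eq empty using le[OF le'] assms(2-) by (simp add: mn mx)
  qed
qed

text \<open>Refining both boxes to a common grid writes the two products as sums over strictly increasing
  choices of grid cells; by independence only pairs of equal choices contribute to the expectation.\<close>

proposition wiener_box_inc_product:
  assumes W: "wiener_measure M"
    and p: "simplex_box k (fst p) (snd p)" and q: "simplex_box l (fst q) (snd q)"
  shows "integrable M (\<lambda>\<omega>. box_inc k p \<omega> * box_inc l q \<omega>)"
    and "(LINT \<omega>|M. box_inc k p \<omega> * box_inc l q \<omega>) =
      (if k = l then \<Prod>i<k. max 0 (min (snd p i) (snd q i) - max (fst p i) (fst q i)) else 0)"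
proof -
  define T where "T = fst p ` {..<k} \<union> snd p ` {..<k} \<union> fst q ` {..<l} \<union> snd q ` {..<l}"
  have T: "finite T" "T \<subseteq> {0..1}"
    using p q by (fastforce simp: T_def simplex_box_def)+
  obtain t and N :: nat where grid: "\<forall>i\<le>N. t i \<in> {0..1::real}" "\<forall>j\<le>N. \<forall>i<j. t i < t j"
    "\<forall>x\<in>T. \<exists>i\<le>N. x = t i"
    using ex_common_grid[OF T] by blast
  have t: "\<And>i. i \<le> N \<Longrightarrow> t i \<in> {0..1}" "\<And>i j. i < j \<Longrightarrow> j \<le> N \<Longrightarrow> t i < t j"
    and cover: "\<And>x. x \<in> T \<Longrightarrow> \<exists>i\<le>N. x = t i"
    by (use grid(1) in blast, use grid(2) in blast, use grid(3) in blast)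
  have pick: "\<exists>u. \<forall>i. i < n \<longrightarrow> u i \<le> N \<and> f i = t (u i)" if "\<And>i. i < n \<Longrightarrow> f i \<in> T" for n :: nat and f
    by (rule choice) (use cover[OF that] in blast)
  obtain u where u: "\<forall>i<k. u i \<le> N \<and> fst p i = t (u i)"
    using pick[of k "fst p"] by (auto simp: T_def)
  obtain v where v: "\<forall>i<k. v i \<le> N \<and> snd p i = t (v i)"
    using pick[of k "snd p"] by (auto simp: T_def)
  obtain u' where u': "\<forall>i<l. u' i \<le> N \<and> fst q i = t (u' i)"
    using pick[of l "fst q"] by (auto simp: T_def)
  obtain v' where v': "\<forall>i<l. v' i \<le> N \<and> snd q i = t (v' i)"
    using pick[of l "snd q"] by (auto simp: T_def)
  note gp = box_inc_grid[OF grid(2) p u v]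
  note gq = box_inc_grid[OF grid(2) q u' v']
  let ?A = "PiE {..<k} (\<lambda>i. {u i..<v i})" and ?B = "PiE {..<l} (\<lambda>i. {u' i..<v' i})"
  let ?D = "\<lambda>S \<omega>. \<Prod>m\<in>S. \<omega> (t (Suc m)) - \<omega> (t m) :: real"
  have expand: "box_inc k p \<omega> * box_inc l q \<omega> =
      (\<Sum>\<phi>\<in>?A. \<Sum>\<psi>\<in>?B. ?D (\<phi> ` {..<k}) \<omega> * ?D (\<psi> ` {..<l}) \<omega>)" for \<omega>
    unfolding gp(1)[of \<omega>] gq(1)[of \<omega>] sum_product ..
  have grid: "integrable M (\<lambda>\<omega>. ?D (\<phi> ` {..<k}) \<omega> * ?D (\<psi> ` {..<l}) \<omega>)"
    and grid_integral: "(LINT \<omega>|M. ?D (\<phi> ` {..<k}) \<omega> * ?D (\<psi> ` {..<l}) \<omega>) =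
      (if \<phi> ` {..<k} = \<psi> ` {..<l} then \<Prod>m\<in>\<phi> ` {..<k}. t (Suc m) - t m else 0)"
    if "\<phi> \<in> ?A" "\<psi> \<in> ?B" for \<phi> \<psi>
    by (rule wiener_grid_product[OF W t(1) t(2) gp(3) gq(3)]; use that in simp)+
  show "integrable M (\<lambda>\<omega>. box_inc k p \<omega> * box_inc l q \<omega>)"
    unfolding expand by (intro Bochner_Integration.integrable_sum grid)
  have same: "\<phi> ` {..<k} = \<psi> ` {..<l} \<longleftrightarrow> k = l \<and> \<phi> = \<psi>" if "\<phi> \<in> ?A" "\<psi> \<in> ?B" for \<phi> \<psi>
  proof
    assume "\<phi> ` {..<k} = \<psi> ` {..<l}"
    then have eq: "k = l \<and> (\<forall>i<k. \<phi> i = \<psi> i)"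
      using gp(2)[OF that(1)] gq(2)[OF that(2)] by (intro strict_mono_image_eq) auto
    \<comment> \<open>Choices are \<open>undefined\<close> off their index set, so agreement below k
      makes them equal as functions.\<close>
    have "\<phi> \<in> extensional {..<k}" "\<psi> \<in> extensional {..<k}"
      using that eq by (simp_all add: PiE_iff)
    then have "\<phi> = \<psi>"
      by (rule extensionalityI) (use eq in simp)
    then show "k = l \<and> \<phi> = \<psi>"
      using eq by simp
  qed auto
  have inj: "inj_on \<phi> {..<k}" if "\<phi> \<in> ?A" for \<phi>
    using gp(2)[OF that] by (intro strict_mono_on_imp_inj_on[where A = "{..<k}"] strict_mono_onI) auto
  have "(LINT \<omega>|M. box_inc k p \<omega> * box_inc l q \<omega>) =
      (\<Sum>\<phi>\<in>?A. LINT \<omega>|M. (\<Sum>\<psi>\<in>?B. ?D (\<phi> ` {..<k}) \<omega> * ?D (\<psi> ` {..<l}) \<omega>))"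
    unfolding expand by (intro Bochner_Integration.integral_sum Bochner_Integration.integrable_sum grid)
  also have "\<dots> = (\<Sum>\<phi>\<in>?A. \<Sum>\<psi>\<in>?B. LINT \<omega>|M. ?D (\<phi> ` {..<k}) \<omega> * ?D (\<psi> ` {..<l}) \<omega>)"
    by (intro sum.cong refl Bochner_Integration.integral_sum grid)
  also have "\<dots> = (\<Sum>\<phi>\<in>?A. \<Sum>\<psi>\<in>?B. if k = l \<and> \<phi> = \<psi> then \<Prod>i<k. t (Suc (\<phi> i)) - t (\<phi> i) else 0)"
  proof (intro sum.cong refl)
    fix \<phi> \<psi> assume A: "\<phi> \<in> ?A" and B: "\<psi> \<in> ?B"
    show "(LINT \<omega>|M. ?D (\<phi> ` {..<k}) \<omega> * ?D (\<psi> ` {..<l}) \<omega>) =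
        (if k = l \<and> \<phi> = \<psi> then \<Prod>i<k. t (Suc (\<phi> i)) - t (\<phi> i) else 0)"
      unfolding grid_integral[OF A B] same[OF A B]
      using prod.reindex[OF inj[OF A], of "\<lambda>m. t (Suc m) - t m"] by (auto simp: o_def)
  qed
  also have "\<dots> = (if k = l then \<Prod>i<k. max 0 (min (snd p i) (snd q i) - max (fst p i) (fst q i)) else 0)"
  proof (cases "k = l")
    case True
    have fin: "finite ?A" "finite ?B"
      by (auto intro: finite_PiE)
    have "(\<Sum>\<phi>\<in>?A. \<Sum>\<psi>\<in>?B. if k = l \<and> \<phi> = \<psi> then \<Prod>i<k. t (Suc (\<phi> i)) - t (\<phi> i) else 0) =
        (\<Sum>\<phi>\<in>?A. if \<phi> \<in> ?B then \<Prod>i<k. t (Suc (\<phi> i)) - t (\<phi> i) else 0)"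
      using True fin by (intro sum.cong refl) (simp add: sum.delta)
    also have "\<dots> = (\<Sum>\<phi>\<in>?A \<inter> ?B. \<Prod>i<k. t (Suc (\<phi> i)) - t (\<phi> i))"
      using fin by (simp add: sum.inter_restrict)
    \<comment> \<open>A choice on the diagonal is admissible for both boxes: in every coordinate it
      picks a cell common to the two intervals. The sum therefore factors over the coordinates
      again.\<close>
    also have "?A \<inter> ?B = PiE {..<k} (\<lambda>i. {u i..<v i} \<inter> {u' i..<v' i})"
      using True by (simp add: PiE_Int)
    also have "(\<Sum>\<phi>\<in>\<dots>. \<Prod>i<k. t (Suc (\<phi> i)) - t (\<phi> i)) =
        (\<Prod>i<k. \<Sum>m\<in>{u i..<v i} \<inter> {u' i..<v' i}. t (Suc m) - t m)"
      by (rule prod_sum_PiE[symmetric]) auto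
    also have "\<dots> = (\<Prod>i<k. max 0 (min (snd p i) (snd q i) - max (fst p i) (fst q i)))"
      using u v u' v' True by (intro prod.cong refl, subst sum_grid_Int[OF t(2)]) auto
    finally show ?thesis
      using True by simp
  qed simp
  finally show "(LINT \<omega>|M. box_inc k p \<omega> * box_inc l q \<omega>) =
      (if k = l then \<Prod>i<k. max 0 (min (snd p i) (snd q i) - max (fst p i) (fst q i)) else 0)" .
qed

section \<open>The isometry for elementary integrals and its closure\<close>

lemma elementary_integral_alt:
  "elementary_integral k L \<omega> = (\<Sum>x\<leftarrow>L. fst x * complex_of_real (box_inc k (snd x) \<omega>))"
  by (simp add: elementary_integral_def case_prod_unfold)

text \<open>Both inner products expand over pairs of boxes. For k = l the entries agree, being the
  product of the overlap lengths of the two boxes; for different orders every expectation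
  vanishes.\<close>

lemma L2_inner_elementary_integral:
  assumes W: "wiener_measure M" and L: "elementary k L" "elementary l L'"
  shows "L2_inner M (elementary_integral k L) (elementary_integral l L') =
    (if k = l then L2_inner (simplex_measure k) (elementary_fun k L) (elementary_fun k L') else 0)"
proof -
  note box = elementary_simplex_box[OF L(1)] elementary_simplex_box[OF L(2)]
  have "L2_inner M (elementary_integral k L) (elementary_integral l L') =
      (\<Sum>x\<leftarrow>L. \<Sum>y\<leftarrow>L'. fst x * cnj (fst y) *
        complex_of_real (LINT \<omega>|M. box_inc k (snd x) \<omega> * box_inc l (snd y) \<omega>))"
    using integral_sum_list_mult[of L L' M "box_inc k" "box_inc l" "\<lambda>_. 1"]
      wiener_box_inc_product(1)[OF W box(1) box(2)]
    by (simp add: L2_inner_def elementary_integral_alt)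
  also have "\<dots> = (\<Sum>x\<leftarrow>L. \<Sum>y\<leftarrow>L'. fst x * cnj (fst y) * complex_of_real
      (if k = l then LINT s|simplex_measure k. box_ind k (snd x) s * box_ind k (snd y) s * 1 else 0))"
  proof (intro arg_cong[where f = sum_list] map_cong refl arg_cong2[where f = "(*)"]
      arg_cong[where f = complex_of_real])
    fix x y assume x: "x \<in> set L" and y: "y \<in> set L'"
    show "(LINT \<omega>|M. box_inc k (snd x) \<omega> * box_inc l (snd y) \<omega>) =
        (if k = l then LINT s|simplex_measure k. box_ind k (snd x) s * box_ind k (snd y) s * 1 else 0)"
    proof (cases "k = l")
      case True
      \<comment> \<open>The constant weight is written as a product of ones to fit the factorised
        form of the integral.\<close>
      have "(LINT s|simplex_measure k. box_ind k (snd x) s * box_ind k (snd y) s * 1) =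
          (LINT s|simplex_measure k. box_ind k (snd x) s * box_ind k (snd y) s * (\<Prod>i<k. 1))"
        by simp
      also have "\<dots> = (\<Prod>i<k. LINT z|lborel. indicator ({fst (snd x) i<..snd (snd x) i} \<inter>
          {fst (snd y) i<..snd (snd y) i}) z * 1)"
        by (rule integral_simplex_box[where C = "\<lambda>_. 1"]) (use box(1)[OF x] in auto)
      also have "\<dots> = (LINT \<omega>|M. box_inc k (snd x) \<omega> * box_inc l (snd y) \<omega>)"
        unfolding wiener_box_inc_product(2)[OF W box(1)[OF x] box(2)[OF y]] mult_1_right
          integral_indicator_Ioc_Int using True by simp
      finally show ?thesis
        using True by simp
    next
      case False
      then show ?thesis
        using wiener_box_inc_product(2)[OF W box(1)[OF x] box(2)[OF y]] by simp
    qed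
  qed
  also have "\<dots> = (if k = l then L2_inner (simplex_measure k) (elementary_fun k L) (elementary_fun k L') else 0)"
    using elementary_fun_gram[of "\<lambda>_. 1" k 1 L L'] by (auto simp: L2_inner_def)
  finally show ?thesis .
qed

lemma wiener_integral_L2:
  assumes "wiener_integral M k f X"
  shows "f \<in> L2 (simplex_measure k)" "X \<in> L2 M"
  using assms by (auto simp: wiener_integral_def L2_tendsto_def)

text \<open>Both sides are limits of the elementary identity, whichever approximating sequences
  realise the two integrals. Hence it applies to any version, in particular to the one returned by a
  phase isometry.\<close>

proposition wiener_integral_inner:
  assumes W: "wiener_measure M" and X: "wiener_integral M k f X" and Y: "wiener_integral M l g Y"
  shows "L2_inner M X Y = (if k = l then L2_inner (simplex_measure k) f g else 0)"
proof -
  obtain L where L: "\<And>N. elementary k (L N)"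
    "L2_tendsto (simplex_measure k) (\<lambda>N. elementary_fun k (L N)) f"
    "L2_tendsto M (\<lambda>N. elementary_integral k (L N)) X"
    using X by (auto simp: wiener_integral_def)
  obtain L' where L': "\<And>N. elementary l (L' N)"
    "L2_tendsto (simplex_measure l) (\<lambda>N. elementary_fun l (L' N)) g"
    "L2_tendsto M (\<lambda>N. elementary_integral l (L' N)) Y"
    using Y by (auto simp: wiener_integral_def)
  have "(\<lambda>N. L2_inner M (elementary_integral k (L N)) (elementary_integral l (L' N))) \<longlonglongrightarrow> L2_inner M X Y"
    by (rule L2_tendsto_inner[OF L(3) L'(3)])
  moreover have "(\<lambda>N. L2_inner M (elementary_integral k (L N)) (elementary_integral l (L' N)))
      \<longlonglongrightarrow> (if k = l then L2_inner (simplex_measure k) f g else 0)"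
    unfolding L2_inner_elementary_integral[OF W L(1) L'(1)]
    using L2_tendsto_inner[OF L(2)] L'(2) by (cases "k = l") auto
  ultimately show ?thesis
    by (rule LIMSEQ_unique)
qed

lemma wiener_integral_norm:
  assumes "wiener_measure M" "wiener_integral M k f X"
  shows "(L2_norm M X)\<^sup>2 = (L2_norm (simplex_measure k) f)\<^sup>2"
proof -
  have "complex_of_real ((L2_norm M X)\<^sup>2) = complex_of_real ((L2_norm (simplex_measure k) f)\<^sup>2)"
    using wiener_integral_inner[OF assms assms(2)] unfolding L2_inner_self by (simp only: refl if_True)
  then show ?thesis
    unfolding of_real_eq_iff .
qed

text \<open>The differences are expanded sesquilinearly and the isometry is applied to the four
  resulting pairs, which bypasses building an approximating sequence for the difference of two
  integrals. It is used with X = R_n Z_k and X' = Z_k.\<close>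

lemma wiener_integral_diff_inner:
  assumes W: "wiener_measure M"
    and X: "wiener_integral M k f X" "wiener_integral M k f' X'"
    and Y: "wiener_integral M l g Y" "wiener_integral M l g' Y'"
  shows "L2_inner M (\<lambda>\<omega>. X \<omega> - X' \<omega>) (\<lambda>\<omega>. Y \<omega> - Y' \<omega>) =
    (if k = l then L2_inner (simplex_measure k) (\<lambda>s. f s - f' s) (\<lambda>s. g s - g' s) else 0)"
proof -
  have diff: "L2_inner M' (\<lambda>\<omega>. A \<omega> - A' \<omega>) (\<lambda>\<omega>. B \<omega> - B' \<omega>) =
      L2_inner M' A B - L2_inner M' A B' - (L2_inner M' A' B - L2_inner M' A' B')"
    if "A \<in> L2 M'" "A' \<in> L2 M'" "B \<in> L2 M'" "B' \<in> L2 M'" for M' :: "'b measure" and A A' B B'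
    using L2_inner_lincomb_left[OF that(1,2) L2_diff[OF that(3,4)], of 1 "-1"]
      L2_inner_lincomb_right[OF that(3,4) that(1), of 1 "-1"]
      L2_inner_lincomb_right[OF that(3,4) that(2), of 1 "-1"]
    by simp
  note L2s = wiener_integral_L2[OF X(1)] wiener_integral_L2[OF X(2)]
    wiener_integral_L2[OF Y(1)] wiener_integral_L2[OF Y(2)]
  show ?thesis
  proof (cases "k = l")
    case True
    then show ?thesis
      using L2s X Y by (simp add: diff wiener_integral_inner[OF W])
  next
    case False
    then show ?thesis
      using L2s X Y by (simp add: diff wiener_integral_inner[OF W, where k = k and l = l])
  qed
qed

section \<open>Periodic averaging\<close>

lemma integrable_indicator_bounded:
  fixes h :: "real \<Rightarrow> real"
  assumes "h \<in> borel_measurable borel" "\<And>x. \<bar>h x\<bar> \<le> C"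
  shows "integrable lborel (\<lambda>x. indicator {a<..b} x * h x)"
proof (rule Bochner_Integration.integrable_bound)
  have "emeasure lborel {a<..b} < \<infinity>"
    by (cases "a \<le> b") auto
  then show "integrable lborel (\<lambda>x. indicator {a<..b} x * C)"
    by (intro integrable_mult_left integrable_real_indicator) auto
  show "(\<lambda>x. indicator {a<..b} x * h x) \<in> borel_measurable lborel"
    using assms(1) by simp
  show "AE x in lborel. norm (indicator {a<..b} x * h x) \<le> norm (indicator {a<..b} x * C)"
    using assms(2) by (intro AE_I2) (auto simp: indicator_def intro: order_trans[OF _ abs_ge_self])
qed

text \<open>Whole periods contribute nothing, and the part of (0,x] beyond the last whole period
  costs at most C; the difference of two such integrals costs 2C. The bound does not depend on the
  length of the interval, which is what the rescaling by n exploits.\<close>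

lemma periodic_mean_zero_integral_bound:
  fixes h :: "real \<Rightarrow> real"
  assumes meas: "h \<in> borel_measurable borel" and bd: "\<And>x. \<bar>h x\<bar> \<le> C"
    and per: "\<And>x. h (x + 1) = h x" and mean: "(LINT x|lborel. indicator {0<..1} x * h x) = 0"
    and "0 \<le> a" "a \<le> b"
  shows "\<bar>LINT x|lborel. indicator {a<..b} x * h x\<bar> \<le> 2 * C"
proof -
  define I where "I x y = (LINT u|lborel. indicator {x<..y} u * h u)" for x y
  note int = integrable_indicator_bounded[OF meas bd]
  have add: "I x z = I x y + I y z" if "x \<le> y" "y \<le> z" for x y z
  proof -
    have "I x z = (LINT u|lborel. indicator {x<..y} u * h u + indicator {y<..z} u * h u)"
      unfolding I_def using that by (intro Bochner_Integration.integral_cong) (auto simp: indicator_def)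
    then show ?thesis
      unfolding I_def using int by simp
  qed
  have le: "\<bar>I x y\<bar> \<le> C * (y - x)" if "x \<le> y" for x y
  proof -
    have "\<bar>I x y\<bar> \<le> (LINT u|lborel. \<bar>indicator {x<..y} u * h u\<bar>)"
      unfolding I_def by (rule integral_abs_bound)
    also have "\<dots> \<le> (LINT u|lborel. indicator {x<..y} u * C)"
      using bd int by (intro integral_mono integrable_abs integrable_indicator_bounded[of "\<lambda>_. C" "\<bar>C\<bar>"])
        (auto simp: indicator_def)
    also have "\<dots> = C * (y - x)"
      using that by (simp add: mult.commute)
    finally show ?thesis .
  qed
  have per_nat: "h (real m + x) = h x" for m x
  proof (induction m)
    case (Suc m)
    then show ?case
      using per[of "real m + x"] by (simp add: add_ac)
  qed simp
  have shift: "I (real m) (real m + 1) = 0" for m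
  proof -
    have "I (real m) (real m + 1) = (LINT u|lborel. indicator {real m<..real m + 1} (real m + 1 * u) * h (real m + 1 * u))"
      unfolding I_def by (subst lborel_integral_real_affine[where c = 1 and t = "real m"]) auto
    also have "\<dots> = (LINT u|lborel. indicator {0<..1} u * h u)"
      by (intro Bochner_Integration.integral_cong) (auto simp: indicator_def per_nat)
    finally show ?thesis
      using mean by simp
  qed
  have nat: "I 0 (real m) = 0" for m
  proof (induction m)
    case 0
    then show ?case by (simp add: I_def)
  next
    case (Suc m)
    then show ?case
      using add[of 0 "real m" "real m + 1"] shift[of m] by (simp add: add.commute)
  qed
  have C: "0 \<le> C"
    using bd[of 0] by linarith
  have "\<bar>I 0 x\<bar> \<le> C" if "0 \<le> x" for x
  proof -
    define m where "m = nat \<lfloor>x\<rfloor>"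
    have m: "real m \<le> x" "x - real m \<le> 1"
      using that by (auto simp: m_def) linarith
    have "\<bar>I 0 x\<bar> \<le> C * (x - real m)"
      using add[of 0 "real m" x] le[OF m(1)] nat[of m] m by simp
    also have "\<dots> \<le> C"
      using m C mult_left_mono[of "x - real m" 1 C] by simp
    finally show ?thesis .
  qed
  from this[of a] this[of b] show ?thesis
    using add[of 0 a b] assms(5,6) by (simp add: I_def)
qed

text \<open>Centre h at its mean and substitute y = n x: the integral becomes 1/n times one over
  (na, nb], which is bounded uniformly, so the error is O(1/n). The maximum admits empty intervals,
  which arise as overlaps of disjoint boxes.\<close>

lemma periodic_average:
  fixes h :: "real \<Rightarrow> real"
  assumes meas: "h \<in> borel_measurable borel" and bd: "\<And>x. \<bar>h x\<bar> \<le> C"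
    and per: "\<And>x. h (x + 1) = h x" and mean: "(LINT x|lborel. indicator {0<..1} x * h x) = \<mu>"
    and "0 \<le> a"
  shows "(\<lambda>n. LINT x|lborel. indicator {a<..b} x * h (real n * x)) \<longlonglongrightarrow> max 0 (b - a) * \<mu>"
proof (cases "a \<le> b")
  case True
  let ?h = "\<lambda>x. h x - \<mu>"
  have bd': "\<bar>?h x\<bar> \<le> C + \<bar>\<mu>\<bar>" for x
    using bd[of x] by linarith
  have mean': "(LINT x|lborel. indicator {0<..1} x * ?h x) = 0"
    using mean integrable_indicator_bounded[OF meas bd, of 0 1]
    by (simp add: right_diff_distrib)
  have est: "\<bar>(LINT x|lborel. indicator {a<..b} x * h (real n * x)) - (b - a) * \<mu>\<bar> \<le> 2 * (C + \<bar>\<mu>\<bar>) / real n"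
    if n: "n \<ge> 1" for n
  proof -
    have int: "integrable lborel (\<lambda>x. indicator {a<..b} x * h (real n * x))"
      using meas bd by (intro integrable_indicator_bounded[where C = C]) auto
    have "(LINT x|lborel. indicator {real n * a<..real n * b} x * ?h x) =
        real n * (LINT x|lborel. indicator {real n * a<..real n * b} (real n * x) * ?h (real n * x))"
      using n by (subst lborel_integral_real_affine[where c = "real n" and t = 0]) auto
    also have "(LINT x|lborel. indicator {real n * a<..real n * b} (real n * x) * ?h (real n * x)) =
        (LINT x|lborel. indicator {a<..b} x * ?h (real n * x))"
      using n by (intro Bochner_Integration.integral_cong) (auto simp: indicator_def)
    also have "\<dots> = (LINT x|lborel. indicator {a<..b} x * h (real n * x)) - (b - a) * \<mu>"
      using int True by (simp add: right_diff_distrib)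
    finally have eq: "(LINT x|lborel. indicator {real n * a<..real n * b} x * ?h x) =
        real n * ((LINT x|lborel. indicator {a<..b} x * h (real n * x)) - (b - a) * \<mu>)" .
    have "\<bar>LINT x|lborel. indicator {real n * a<..real n * b} x * ?h x\<bar> \<le> 2 * (C + \<bar>\<mu>\<bar>)"
      using meas per mean' True \<open>0 \<le> a\<close> n
      by (intro periodic_mean_zero_integral_bound bd') (auto intro: mult_left_mono)
    then show ?thesis
      unfolding eq using n by (simp add: abs_mult pos_le_divide_eq mult.commute)
  qed
  have "(\<lambda>n. 2 * (C + \<bar>\<mu>\<bar>) / real n) \<longlonglongrightarrow> 0"
    by (rule lim_const_over_n)
  then have "(\<lambda>n. (LINT x|lborel. indicator {a<..b} x * h (real n * x)) - (b - a) * \<mu>) \<longlonglongrightarrow> 0"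
    by (rule Lim_null_comparison[rotated])
      (use est in \<open>auto intro!: eventually_mono[OF eventually_ge_at_top[of 1]]\<close>)
  then show ?thesis
    using True by (simp add: LIM_zero_iff)
qed simp

text \<open>The phase isometry multiplies kernels by \<open>exp (\<i> * osc k \<theta> n s / n)\<close>.\<close>

definition osc :: "nat \<Rightarrow> (real \<Rightarrow> real) \<Rightarrow> nat \<Rightarrow> (nat \<Rightarrow> real) \<Rightarrow> real" where
  "osc k \<theta> n s = (\<Sum>j<k. \<theta> (real n * s j))"

text \<open>The period is half-open to match the half-open boxes and to tile the line by translates.
  The bound C is at least 1 so that it dominates both \<theta> and the constant factor 1 in
  coordinate products.\<close>

locale oscillation =
  fixes \<theta> :: "real \<Rightarrow> real" and C :: real
  assumes meas: "\<theta> \<in> borel_measurable borel"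
    and bd: "\<And>x. \<bar>\<theta> x\<bar> \<le> C" and C1: "1 \<le> C"
    and per: "\<And>x. \<theta> (x + 1) = \<theta> x"
    and mean0: "(LINT x|lborel. indicator {0<..1} x * \<theta> x) = 0"
    and mean1: "(LINT x|lborel. indicator {0<..1} x * (\<theta> x)\<^sup>2) = 1"
begin

section \<open>Averages of the squared oscillation\<close>

lemma osc_measurable [measurable]: "osc k \<theta> n \<in> borel_measurable (simplex_measure k)"
  unfolding osc_def[abs_def]
proof (intro borel_measurable_sum)
  fix j assume "j \<in> {..<k}"
  then have "(\<lambda>s. s j) \<in> borel_measurable (simplex_measure k)"
    by (intro simplex_coordinate_measurable) simp
  then have "(\<lambda>s. real n * s j) \<in> borel_measurable (simplex_measure k)"
    by simp
  then show "(\<lambda>s. \<theta> (real n * s j)) \<in> borel_measurable (simplex_measure k)"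
    by (rule measurable_compose[OF _ meas])
qed

lemma osc_bound: "\<bar>osc k \<theta> n s\<bar> \<le> real k * C"
proof -
  have "\<bar>osc k \<theta> n s\<bar> \<le> (\<Sum>j<k. \<bar>\<theta> (real n * s j)\<bar>)"
    unfolding osc_def by (rule sum_abs)
  also have "\<dots> \<le> (\<Sum>j<k. C)"
    by (intro sum_mono bd)
  finally show ?thesis by simp
qed

lemma osc_square_bound: "\<bar>(osc k \<theta> n s)\<^sup>2\<bar> \<le> (real k * C)\<^sup>2"
  using osc_bound[of k n s] by (simp add: abs_le_square_iff[symmetric])

text \<open>The l-th coordinate factor of \<theta>(n s_i) \<theta>(n s_j) is the square of \<theta>
  if l = i = j, \<theta> itself if l equals exactly one of i and j, and 1 otherwise. Mean square one
  makes the first case indistinguishable from the last in the limit.\<close>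

lemma pair_factor_tendsto:
  assumes "0 \<le> a"
  shows "(\<lambda>n. LINT x|lborel. indicator {a<..b} x *
      ((if l = i then \<theta> (real n * x) else 1) * (if l = j then \<theta> (real n * x) else 1)))
    \<longlonglongrightarrow> max 0 (b - a) * (if (l = i) = (l = j) then 1 else 0)"
proof -
  have sq: "\<bar>(\<theta> x)\<^sup>2\<bar> \<le> C\<^sup>2" for x
    using bd[of x] C1 by (simp add: abs_le_square_iff[symmetric])
  have "(\<lambda>n. LINT x|lborel. indicator {a<..b} x * \<theta> (real n * x)) \<longlonglongrightarrow> max 0 (b - a) * 0"
    by (rule periodic_average[OF meas bd per mean0 assms])
  moreover have "(\<lambda>n. LINT x|lborel. indicator {a<..b} x * (\<theta> (real n * x))\<^sup>2) \<longlonglongrightarrow> max 0 (b - a) * 1"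
    using meas by (intro periodic_average[OF _ sq _ mean1 assms]) (auto simp: per)
  moreover have "(LINT x|lborel. indicator {a<..b} x) = max 0 (b - a)"
    using integral_indicator_Ioc_Int[of a b a b] by simp
  ultimately show ?thesis
    by (cases "l = i"; cases "l = j") (simp_all add: power2_eq_square)
qed

text \<open>Every term of the double sum over (i,j) factors over the coordinates. For i \<noteq> j
  the coordinate l = i has limit 0 and removes the term, while each of the k diagonal terms tends to
  the volume of the overlap.\<close>

lemma box_osc_square_tendsto:
  assumes p: "simplex_box k (fst p) (snd p)"
  shows "(\<lambda>n. LINT s|simplex_measure k. box_ind k p s * box_ind k q s * (osc k \<theta> n s)\<^sup>2) \<longlonglongrightarrow>
    real k * (LINT s|simplex_measure k. box_ind k p s * box_ind k q s)"
proof -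
  define g where "g i j n l x =
    (if l = i then \<theta> (real n * x) else 1) * (if l = j then \<theta> (real n * x) else 1)" for i j n and l :: nat and x
  define c where "c l = max 0 (min (snd p l) (snd q l) - max (fst p l) (fst q l))" for l
  have g_meas: "g i j n l \<in> borel_measurable borel" for i j n l
    unfolding g_def[abs_def] using meas by simp
  have g_bd: "\<bar>g i j n l x\<bar> \<le> C * C" for i j n l x
    unfolding g_def abs_mult using bd C1 by (intro mult_mono) auto
  have prod_meas: "(\<lambda>s. \<Prod>l<k. g i j n l (s l)) \<in> borel_measurable (simplex_measure k)" for i j n
    by (intro borel_measurable_prod measurable_compose[OF simplex_coordinate_measurable g_meas]) simp
  have prod_bd: "\<bar>\<Prod>l<k. g i j n l (s l)\<bar> \<le> (C * C) ^ k" for i j n s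
    using prod_mono[of "{..<k}" "\<lambda>l. \<bar>g i j n l (s l)\<bar>" "\<lambda>_. C * C"] g_bd by (simp add: abs_prod)
  have osc: "(osc k \<theta> n s)\<^sup>2 = (\<Sum>i<k. \<Sum>j<k. \<Prod>l<k. g i j n l (s l))" for n s
  proof -
    have "(\<Prod>l<k. g i j n l (s l)) = \<theta> (real n * s i) * \<theta> (real n * s j)" if "i < k" "j < k" for i j
      using that unfolding g_def prod.distrib by (simp add: prod.delta)
    then show ?thesis
      by (simp add: osc_def power2_eq_square sum_product)
  qed
  have expand: "(LINT s|simplex_measure k. box_ind k p s * box_ind k q s * (osc k \<theta> n s)\<^sup>2) =
      (\<Sum>i<k. \<Sum>j<k. \<Prod>l<k. LINT x|lborel. indicator ({fst p l<..snd p l} \<inter> {fst q l<..snd q l}) x * g i j n l x)" for n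
    unfolding osc sum_distrib_left
    by (simp add: Bochner_Integration.integral_sum Bochner_Integration.integrable_sum
        integrable_box_ind_mult[OF prod_meas prod_bd] integral_simplex_box[OF p g_meas g_bd]
        del: Int_greaterThanAtMost)
  have vol: "(LINT s|simplex_measure k. box_ind k p s * box_ind k q s) = (\<Prod>l<k. c l)"
  proof -
    have "(LINT s|simplex_measure k. box_ind k p s * box_ind k q s * (\<Prod>l<k. 1)) =
        (\<Prod>l<k. LINT x|lborel. indicator ({fst p l<..snd p l} \<inter> {fst q l<..snd q l}) x * 1)"
      by (rule integral_simplex_box[OF p, where C = "\<lambda>_. 1"]) auto
    then show ?thesis
      unfolding mult_1_right integral_indicator_Ioc_Int c_def by simp
  qed
  have "(\<lambda>n. \<Sum>i<k. \<Sum>j<k. \<Prod>l<k. LINT x|lborel.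
      indicator ({fst p l<..snd p l} \<inter> {fst q l<..snd q l}) x * g i j n l x) \<longlonglongrightarrow>
      (\<Sum>i<k. \<Sum>j<k. \<Prod>l<k. c l * (if (l = i) = (l = j) then 1 else 0))"
    unfolding g_def c_def Int_greaterThanAtMost
    using p by (intro tendsto_sum tendsto_prod pair_factor_tendsto) (auto simp: simplex_box_def)
  also have "(\<Sum>i<k. \<Sum>j<k. \<Prod>l<k. c l * (if (l = i) = (l = j) then 1 else 0)) =
      (\<Sum>i<k. \<Sum>j<k. if j = i then \<Prod>l<k. c l else 0)"
  proof (intro sum.cong refl)
    fix i j assume "i \<in> {..<k}" "j \<in> {..<k}"
    then show "(\<Prod>l<k. c l * (if (l = i) = (l = j) then 1 else 0)) = (if j = i then \<Prod>l<k. c l else 0)"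
      by (cases "j = i") (auto intro!: prod_zero bexI[of _ i])
  qed
  also have "\<dots> = real k * (\<Prod>l<k. c l)"
    by simp
  finally show ?thesis
    unfolding expand vol .
qed

text \<open>The boxes of a step function may overlap, so its squared modulus is expanded over all
  pairs of boxes; this is why averaging is proved for products of two indicators. The coefficients
  are complex, so the limit is taken in the complex numbers and read back as a real one at the
  end.\<close>

lemma elementary_osc_square_tendsto:
  assumes L: "elementary k L"
  shows "(\<lambda>n. LINT s|simplex_measure k. (cmod (elementary_fun k L s))\<^sup>2 * (osc k \<theta> n s)\<^sup>2) \<longlonglongrightarrow>
    real k * (LINT s|simplex_measure k. (cmod (elementary_fun k L s))\<^sup>2)"
proof -
  let ?e = "elementary_fun k L"
  have real: "(LINT s|simplex_measure k. ?e s * cnj (?e s) * complex_of_real (w s)) =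
      complex_of_real (LINT s|simplex_measure k. (cmod (?e s))\<^sup>2 * w s)" for w
    unfolding complex_norm_square[symmetric] integral_complex_of_real[symmetric] by simp
  have gram: "complex_of_real (LINT s|simplex_measure k. (cmod (?e s))\<^sup>2 * (osc k \<theta> n s)\<^sup>2) =
      (\<Sum>x\<leftarrow>L. \<Sum>y\<leftarrow>L. fst x * cnj (fst y) * complex_of_real
        (LINT s|simplex_measure k. box_ind k (snd x) s * box_ind k (snd y) s * (osc k \<theta> n s)\<^sup>2))" for n
    unfolding real[symmetric] by (rule elementary_fun_gram[OF _ osc_square_bound]) simp
  have gram1: "complex_of_real (LINT s|simplex_measure k. (cmod (?e s))\<^sup>2) =
      (\<Sum>x\<leftarrow>L. \<Sum>y\<leftarrow>L. fst x * cnj (fst y) * complex_of_real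
        (LINT s|simplex_measure k. box_ind k (snd x) s * box_ind k (snd y) s))"
    using real[of "\<lambda>_. 1"] elementary_fun_gram[of "\<lambda>_. 1" k 1 L L] by simp
  have "(\<lambda>n. \<Sum>x\<leftarrow>L. \<Sum>y\<leftarrow>L. fst x * cnj (fst y) * complex_of_real
        (LINT s|simplex_measure k. box_ind k (snd x) s * box_ind k (snd y) s * (osc k \<theta> n s)\<^sup>2)) \<longlonglongrightarrow>
      (\<Sum>x\<leftarrow>L. \<Sum>y\<leftarrow>L. fst x * cnj (fst y) * complex_of_real
        (real k * (LINT s|simplex_measure k. box_ind k (snd x) s * box_ind k (snd y) s)))"
    unfolding sum_list_eq_sum_nth
    by (intro tendsto_sum tendsto_mult tendsto_const tendsto_of_real box_osc_square_tendsto
        elementary_simplex_box[OF L]) simp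
  also have "(\<Sum>x\<leftarrow>L. \<Sum>y\<leftarrow>L. fst x * cnj (fst y) * complex_of_real
        (real k * (LINT s|simplex_measure k. box_ind k (snd x) s * box_ind k (snd y) s))) =
      complex_of_real (real k * (LINT s|simplex_measure k. (cmod (?e s))\<^sup>2))"
    unfolding of_real_mult gram1 sum_list_eq_sum_nth sum_distrib_left by (simp add: mult_ac)
  finally show ?thesis
    unfolding gram[symmetric] tendsto_of_real_iff .
qed

lemma integrable_kernel_mult:
  assumes f: "f \<in> L2 (simplex_measure k)" and "w \<in> borel_measurable (simplex_measure k)" "\<And>s. \<bar>w s\<bar> \<le> W"
  shows "integrable (simplex_measure k) (\<lambda>s. (cmod (f s))\<^sup>2 * w s)"
proof (rule Bochner_Integration.integrable_bound)
  show "integrable (simplex_measure k) (\<lambda>s. W * (cmod (f s))\<^sup>2)"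
    using L2_integrable[OF f] by simp
  show "(\<lambda>s. (cmod (f s))\<^sup>2 * w s) \<in> borel_measurable (simplex_measure k)"
    using L2_measurable[OF f] assms(2) by simp
  show "AE s in simplex_measure k. norm ((cmod (f s))\<^sup>2 * w s) \<le> norm (W * (cmod (f s))\<^sup>2)"
    using assms(3) by (intro AE_I2) (auto simp: abs_mult mult.commute intro!: mult_right_mono
        intro: order_trans[OF _ abs_ge_self])
qed

text \<open>Averaging extends from step functions by density because the centred weight is bounded
  by V for all n: the step function is chosen first, with an error uniform in n, and only then is n
  taken large.\<close>

proposition kernel_osc_square_tendsto:
  assumes e: "\<And>N. elementary k (L N)" and f: "L2_tendsto (simplex_measure k) (\<lambda>N. elementary_fun k (L N)) f"
  shows "(\<lambda>n. LINT s|simplex_measure k. (cmod (f s))\<^sup>2 * (osc k \<theta> n s)\<^sup>2) \<longlonglongrightarrow>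
    real k * (LINT s|simplex_measure k. (cmod (f s))\<^sup>2)"
proof (rule LIMSEQ_I)
  let ?S = "simplex_measure k"
  note f' = L2_tendstoD[OF f]
  define V where "V = (real k * C)\<^sup>2 + real k"
  define J where "J g n = (LINT s|?S. (cmod (g s))\<^sup>2 * ((osc k \<theta> n s)\<^sup>2 - real k))" for g and n
  have V: "\<bar>(osc k \<theta> n s)\<^sup>2 - real k\<bar> \<le> V" "0 \<le> V" for n s
    using osc_square_bound[of k n s] zero_le_power2[of "osc k \<theta> n s"] unfolding V_def by linarith+
  have J: "J g n = (LINT s|?S. (cmod (g s))\<^sup>2 * (osc k \<theta> n s)\<^sup>2) - real k * (LINT s|?S. (cmod (g s))\<^sup>2)"
    if "g \<in> L2 ?S" for g n
    unfolding J_def using integrable_kernel_mult[OF that _ osc_square_bound] L2_integrable[OF that]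
    by (simp add: right_diff_distrib mult.commute)
  have diff: "\<bar>J f n - J (elementary_fun k (L N)) n\<bar> \<le>
      V * (LINT s|?S. \<bar>(cmod (elementary_fun k (L N) s))\<^sup>2 - (cmod (f s))\<^sup>2\<bar>)" for n N
  proof -
    let ?g = "elementary_fun k (L N)"
    have int: "integrable ?S (\<lambda>s. (cmod (h s))\<^sup>2 * ((osc k \<theta> n s)\<^sup>2 - real k))" if "h \<in> L2 ?S" for h
      by (rule integrable_kernel_mult[OF that _ V(1)]) simp
    have "J f n - J ?g n = (LINT s|?S. ((cmod (f s))\<^sup>2 - (cmod (?g s))\<^sup>2) * ((osc k \<theta> n s)\<^sup>2 - real k))"
      unfolding J_def using int[OF f'(2)] int[OF f'(1)[of N]] by (simp add: left_diff_distrib)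
    also have "\<bar>\<dots>\<bar> \<le> (LINT s|?S. \<bar>((cmod (f s))\<^sup>2 - (cmod (?g s))\<^sup>2) * ((osc k \<theta> n s)\<^sup>2 - real k)\<bar>)"
      by (rule integral_abs_bound)
    also have "\<dots> \<le> (LINT s|?S. V * \<bar>(cmod (?g s))\<^sup>2 - (cmod (f s))\<^sup>2\<bar>)"
    proof (rule integral_mono)
      show "integrable ?S (\<lambda>s. \<bar>((cmod (f s))\<^sup>2 - (cmod (?g s))\<^sup>2) * ((osc k \<theta> n s)\<^sup>2 - real k)\<bar>)"
        using int[OF f'(2)] int[OF f'(1)[of N]] by (simp add: left_diff_distrib)
      show "integrable ?S (\<lambda>s. V * \<bar>(cmod (?g s))\<^sup>2 - (cmod (f s))\<^sup>2\<bar>)"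
        using L2_integrable[OF f'(2)] L2_integrable[OF f'(1)[of N]] by simp
      show "\<bar>((cmod (f s))\<^sup>2 - (cmod (?g s))\<^sup>2) * ((osc k \<theta> n s)\<^sup>2 - real k)\<bar> \<le>
          V * \<bar>(cmod (?g s))\<^sup>2 - (cmod (f s))\<^sup>2\<bar>" for s
        unfolding abs_mult abs_minus_commute[of "(cmod (f s))\<^sup>2"]
        using V(1)[of n s] by (simp add: mult.commute mult_right_mono)
    qed
    finally show ?thesis by simp
  qed
  fix \<epsilon> :: real assume "0 < \<epsilon>"
  have "(\<lambda>N. V * (LINT s|?S. \<bar>(cmod (elementary_fun k (L N) s))\<^sup>2 - (cmod (f s))\<^sup>2\<bar>)) \<longlonglongrightarrow> V * 0"
    by (intro tendsto_mult tendsto_const L2_tendsto_integral_abs f)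
  then obtain N where N: "V * (LINT s|?S. \<bar>(cmod (elementary_fun k (L N) s))\<^sup>2 - (cmod (f s))\<^sup>2\<bar>) < \<epsilon> / 2"
    using order_tendstoD(2)[of _ "V * 0" sequentially "\<epsilon> / 2"] \<open>0 < \<epsilon>\<close>
    by (auto simp: eventually_sequentially)
  have "(\<lambda>n. J (elementary_fun k (L N)) n) \<longlonglongrightarrow> 0"
    unfolding J[OF f'(1)] using elementary_osc_square_tendsto[OF e] by (simp add: LIM_zero)
  then obtain n0 where n0: "\<And>n. n \<ge> n0 \<Longrightarrow> \<bar>J (elementary_fun k (L N)) n\<bar> < \<epsilon> / 2"
    using \<open>0 < \<epsilon>\<close> LIMSEQ_D[of "\<lambda>n. J (elementary_fun k (L N)) n" 0 "\<epsilon> / 2"] by auto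
  show "\<exists>n0. \<forall>n\<ge>n0. norm ((LINT s|?S. (cmod (f s))\<^sup>2 * (osc k \<theta> n s)\<^sup>2) -
      real k * (LINT s|?S. (cmod (f s))\<^sup>2)) < \<epsilon>"
  proof (intro exI allI impI)
    fix n assume "n0 \<le> n"
    then have "\<bar>J f n\<bar> < \<epsilon>"
      using n0[of n] N diff[of n N] by linarith
    then show "norm ((LINT s|?S. (cmod (f s))\<^sup>2 * (osc k \<theta> n s)\<^sup>2) - real k * (LINT s|?S. (cmod (f s))\<^sup>2)) < \<epsilon>"
      by (simp add: J[OF f'(2)])
  qed
qed

end

section \<open>Expansion of the phase to second order\<close>

lemma cmod_iexp_minus_1_le: "cmod (iexp x - 1) \<le> \<bar>x\<bar>"
  using iexp_approx1[of x 0] by simp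

text \<open>Factor the difference of squares: Taylor's formula bounds the difference of the moduli
  by x^2/2, and their sum is at most 2|x|. The cubic order matters, since at x = u/n and after
  multiplication by n^2 it leaves an error of order 1/n.\<close>

lemma cmod_iexp_minus_1_square: "\<bar>(cmod (iexp x - 1))\<^sup>2 - x\<^sup>2\<bar> \<le> \<bar>x\<bar> ^ 3"
proof -
  have "cmod (iexp x - 1 - \<i> * x) \<le> x\<^sup>2 / 2"
    using iexp_approx1[of x 1] by (simp add: power2_eq_square diff_diff_eq)
  moreover have "\<bar>cmod (iexp x - 1) - \<bar>x\<bar>\<bar> \<le> cmod (iexp x - 1 - \<i> * x)"
    using norm_triangle_ineq3[of "iexp x - 1" "\<i> * x"] by (simp add: norm_mult)
  ultimately have d: "\<bar>cmod (iexp x - 1) - \<bar>x\<bar>\<bar> \<le> x\<^sup>2 / 2"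
    by linarith
  have "\<bar>(cmod (iexp x - 1))\<^sup>2 - x\<^sup>2\<bar> = \<bar>cmod (iexp x - 1) - \<bar>x\<bar>\<bar> * (cmod (iexp x - 1) + \<bar>x\<bar>)"
    using square_diff_square_factored[of "cmod (iexp x - 1)" "\<bar>x\<bar>"]
    by (simp add: power2_eq_square abs_mult mult.commute)
  also have "\<dots> \<le> (x\<^sup>2 / 2) * (2 * \<bar>x\<bar>)"
    using d cmod_iexp_minus_1_le[of x] by (intro mult_mono) auto
  finally show ?thesis
    by (simp add: power3_eq_cube power2_eq_square abs_mult_self_eq mult.assoc)
qed

context oscillation begin

lemma phase_kernel_diff:
  "(cmod (f s * (\<Prod>j<k. exp (\<i> / of_nat n * complex_of_real (\<theta> (real n * s j)))) - f s))\<^sup>2 =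
    (cmod (f s))\<^sup>2 * (cmod (iexp (osc k \<theta> n s / real n) - 1))\<^sup>2"
proof -
  have "(\<Prod>j<k. exp (\<i> / of_nat n * complex_of_real (\<theta> (real n * s j)))) = iexp (osc k \<theta> n s / real n)"
    unfolding exp_sum[OF finite_lessThan, symmetric] osc_def sum_distrib_left[symmetric]
      of_real_sum[symmetric] by simp
  moreover have "f s * z - f s = f s * (z - 1)" for z
    by (simp add: right_diff_distrib)
  ultimately show ?thesis
    by (simp add: norm_mult power_mult_distrib)
qed

lemma phase_measurable:
  "(\<lambda>s. (cmod (iexp (osc k \<theta> n s / real n) - 1))\<^sup>2) \<in> borel_measurable (simplex_measure k)"
  by measurable

text \<open>The first-order estimate |e^(ix) - 1| <= |x| cancels n^2 exactly and leaves a bound free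
  of n; integrated against the kernel it becomes a term of the dominating series.\<close>

lemma phase_square_le: "(real n)\<^sup>2 * (cmod (iexp (osc k \<theta> n s / real n) - 1))\<^sup>2 \<le> (real k * C)\<^sup>2"
proof (cases "n = 0")
  case False
  have "(cmod (iexp (osc k \<theta> n s / real n) - 1))\<^sup>2 \<le> \<bar>osc k \<theta> n s / real n\<bar>\<^sup>2"
    by (intro power_mono cmod_iexp_minus_1_le) simp
  also have "\<dots> = (osc k \<theta> n s)\<^sup>2 / (real n)\<^sup>2"
    by (simp add: power_divide)
  finally show ?thesis
    using False osc_square_bound[of k n s] by (simp add: field_simps)
qed simp

lemma phase_diff_le:
  assumes f: "f \<in> L2 (simplex_measure k)"
  shows "(real n)\<^sup>2 * (LINT s|simplex_measure k. (cmod (f s))\<^sup>2 * (cmod (iexp (osc k \<theta> n s / real n) - 1))\<^sup>2)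
    \<le> (real k * C)\<^sup>2 * (LINT s|simplex_measure k. (cmod (f s))\<^sup>2)"
proof -
  let ?\<phi> = "\<lambda>s. (cmod (iexp (osc k \<theta> n s / real n) - 1))\<^sup>2"
  have "(LINT s|simplex_measure k. (cmod (f s))\<^sup>2 * ((real n)\<^sup>2 * ?\<phi> s)) \<le>
      (LINT s|simplex_measure k. (cmod (f s))\<^sup>2 * (real k * C)\<^sup>2)"
  proof (rule integral_mono)
    show "integrable (simplex_measure k) (\<lambda>s. (cmod (f s))\<^sup>2 * ((real n)\<^sup>2 * ?\<phi> s))"
      using phase_measurable phase_square_le
      by (intro integrable_kernel_mult[OF f, where W = "(real k * C)\<^sup>2"]) (auto simp: abs_mult)
    show "integrable (simplex_measure k) (\<lambda>s. (cmod (f s))\<^sup>2 * (real k * C)\<^sup>2)"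
      using L2_integrable[OF f] by simp
  qed (intro mult_left_mono phase_square_le, simp)
  then show ?thesis
    by (simp add: mult.left_commute mult.commute)
qed

text \<open>Replacing n^2 |e^(iu/n) - 1|^2 by u^2 costs at most (kC)^3/n uniformly over the simplex,
  hence a null sequence after integration against |f|^2; the average of u^2 then gives the
  limit.\<close>

proposition phase_diff_tendsto:
  assumes e: "\<And>N. elementary k (L N)" and f: "L2_tendsto (simplex_measure k) (\<lambda>N. elementary_fun k (L N)) f"
  shows "(\<lambda>n. (real n)\<^sup>2 * (LINT s|simplex_measure k. (cmod (f s))\<^sup>2 * (cmod (iexp (osc k \<theta> n s / real n) - 1))\<^sup>2))
    \<longlonglongrightarrow> real k * (LINT s|simplex_measure k. (cmod (f s))\<^sup>2)"
proof -
  let ?S = "simplex_measure k" and ?F = "LINT s|simplex_measure k. (cmod (f s))\<^sup>2"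
  let ?\<phi> = "\<lambda>n s. (cmod (iexp (osc k \<theta> n s / real n) - 1))\<^sup>2"
  let ?J = "\<lambda>n. LINT s|?S. (cmod (f s))\<^sup>2 * ?\<phi> n s" and ?K = "\<lambda>n. LINT s|?S. (cmod (f s))\<^sup>2 * (osc k \<theta> n s)\<^sup>2"
  note f' = L2_tendstoD(2)[OF f]
  have est: "norm ((real n)\<^sup>2 * ?J n - ?K n) \<le> (real k * C) ^ 3 * ?F / real n" if n: "n \<ge> 1" for n
  proof -
    have bound: "\<bar>(real n)\<^sup>2 * ?\<phi> n s - (osc k \<theta> n s)\<^sup>2\<bar> \<le> (real k * C) ^ 3 / real n" for s
    proof -
      have "(real n)\<^sup>2 * ?\<phi> n s - (osc k \<theta> n s)\<^sup>2 = (real n)\<^sup>2 * (?\<phi> n s - (osc k \<theta> n s / real n)\<^sup>2)"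
        using n by (simp add: field_simps)
      then have "\<bar>(real n)\<^sup>2 * ?\<phi> n s - (osc k \<theta> n s)\<^sup>2\<bar> \<le> (real n)\<^sup>2 * \<bar>osc k \<theta> n s / real n\<bar> ^ 3"
        using cmod_iexp_minus_1_square[of "osc k \<theta> n s / real n"]
        by (simp add: abs_mult mult_left_mono)
      also have "\<dots> = \<bar>osc k \<theta> n s\<bar> ^ 3 / real n"
        using n by (simp add: power_divide field_simps power2_eq_square power3_eq_cube)
      also have "\<dots> \<le> (real k * C) ^ 3 / real n"
        by (intro divide_right_mono power_mono osc_bound) auto
      finally show ?thesis .
    qed
    have int: "integrable ?S (\<lambda>s. (cmod (f s))\<^sup>2 * ((real n)\<^sup>2 * ?\<phi> n s))"
      using phase_measurable phase_square_le
      by (intro integrable_kernel_mult[OF f', where W = "(real k * C)\<^sup>2"]) (auto simp: abs_mult)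
    have int': "integrable ?S (\<lambda>s. (cmod (f s))\<^sup>2 * (osc k \<theta> n s)\<^sup>2)"
      by (rule integrable_kernel_mult[OF f' _ osc_square_bound]) simp
    have "(real n)\<^sup>2 * ?J n - ?K n = (LINT s|?S. (cmod (f s))\<^sup>2 * ((real n)\<^sup>2 * ?\<phi> n s)) - ?K n"
      by (simp add: mult.left_commute)
    also have "\<dots> = (LINT s|?S. (cmod (f s))\<^sup>2 * ((real n)\<^sup>2 * ?\<phi> n s - (osc k \<theta> n s)\<^sup>2))"
      unfolding right_diff_distrib by (rule Bochner_Integration.integral_diff[OF int int', symmetric])
    finally have "norm ((real n)\<^sup>2 * ?J n - ?K n) \<le>
        (LINT s|?S. norm ((cmod (f s))\<^sup>2 * ((real n)\<^sup>2 * ?\<phi> n s - (osc k \<theta> n s)\<^sup>2)))"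
      by (simp only: integral_norm_bound)
    also have "\<dots> \<le> (LINT s|?S. (cmod (f s))\<^sup>2 * ((real k * C) ^ 3 / real n))"
    proof (rule integral_mono)
      show "integrable ?S (\<lambda>s. norm ((cmod (f s))\<^sup>2 * ((real n)\<^sup>2 * ?\<phi> n s - (osc k \<theta> n s)\<^sup>2)))"
        unfolding right_diff_distrib
        by (rule integrable_norm[OF Bochner_Integration.integrable_diff[OF int int']])
      show "integrable ?S (\<lambda>s. (cmod (f s))\<^sup>2 * ((real k * C) ^ 3 / real n))"
        using L2_integrable[OF f'] by simp
      show "norm ((cmod (f s))\<^sup>2 * ((real n)\<^sup>2 * ?\<phi> n s - (osc k \<theta> n s)\<^sup>2)) \<le>
          (cmod (f s))\<^sup>2 * ((real k * C) ^ 3 / real n)" for s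
        unfolding norm_mult using bound[of s] by (intro mult_mono) auto
    qed
    finally show ?thesis
      by (simp add: mult.commute)
  qed
  have "(\<lambda>n. (real k * C) ^ 3 * ?F / real n) \<longlonglongrightarrow> 0"
    by (rule lim_const_over_n)
  then have "(\<lambda>n. (real n)\<^sup>2 * ?J n - ?K n) \<longlonglongrightarrow> 0"
    by (rule Lim_null_comparison[rotated])
      (rule eventually_mono[OF eventually_ge_at_top[of 1]], rule est)
  from tendsto_add[OF this kernel_osc_square_tendsto[OF e f]] show ?thesis
    by simp
qed

end

section \<open>The Dirichlet form as a limit\<close>

lemma L2_linear_isometryD:
  assumes "L2_linear_isometry M R"
  shows "X \<in> L2 M \<Longrightarrow> R X \<in> L2 M"
    and "X \<in> L2 M \<Longrightarrow> Y \<in> L2 M \<Longrightarrow>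
      AE \<omega> in M. R (\<lambda>\<omega>. a * X \<omega> + b * Y \<omega>) \<omega> = a * R X \<omega> + b * R Y \<omega>"
    and "X \<in> L2 M \<Longrightarrow> L2_norm M (R X) = L2_norm M X"
  using assms by (auto simp: L2_linear_isometry_def L2_norm_def)

text \<open>Linearity of R holds almost everywhere for each fixed pair, so R X - R Y may be replaced
  by R (X - Y) under the norm.\<close>

lemma L2_isometry_dist:
  assumes R: "L2_linear_isometry M R" and X: "X \<in> L2 M" and Y: "Y \<in> L2 M"
  shows "L2_norm M (\<lambda>\<omega>. R X \<omega> - R Y \<omega>) = L2_norm M (\<lambda>\<omega>. X \<omega> - Y \<omega>)"
proof -
  note R' = L2_linear_isometryD[OF R]
  have "L2_norm M (\<lambda>\<omega>. R X \<omega> - R Y \<omega>) = L2_norm M (R (\<lambda>\<omega>. 1 * X \<omega> + (-1) * Y \<omega>))"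
    using R'(2)[OF X Y, of 1 "-1"]
    by (intro L2_norm_cong_AE L2_diff R'(1) L2_lincomb X Y) auto
  also have "\<dots> = L2_norm M (\<lambda>\<omega>. 1 * X \<omega> + (-1) * Y \<omega>)"
    by (intro R'(3) L2_lincomb X Y)
  finally show ?thesis by simp
qed

lemma L2_isometry_sum:
  assumes R: "L2_linear_isometry M R" and Z: "\<And>k. Z k \<in> L2 M"
  shows "AE \<omega> in M. R (\<lambda>\<omega>. \<Sum>k<K. Z k \<omega>) \<omega> = (\<Sum>k<K::nat. R (Z k) \<omega>)"
proof (induction K)
  case 0
  \<comment> \<open>Linearity with both coefficients 0 shows that R sends the zero function to 0
    almost everywhere.\<close>
  show ?case
    using L2_linear_isometryD(2)[where a = 0 and b = 0, OF R Z Z] by simp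
next
  case (Suc K)
  have "AE \<omega> in M. R (\<lambda>\<omega>. 1 * (\<Sum>k<K. Z k \<omega>) + 1 * Z K \<omega>) \<omega> =
      1 * R (\<lambda>\<omega>. \<Sum>k<K. Z k \<omega>) \<omega> + 1 * R (Z K) \<omega>"
    by (intro L2_linear_isometryD(2)[OF R] L2_sum Z) simp
  with Suc show ?case
    by eventually_elim simp
qed

text \<open>The kernel rule of \<open>phase_isometry\<close> starts at k = 1, and an element of the
  chaos of order 0 is given as an L2 limit of constants. For a constant c, which R fixes, the norm
  of R X - X is at most that of R c - R X plus that of c - X, and these two are equal by
  isometry.\<close>

lemma phase_isometry_chaos_0:
  assumes R: "phase_isometry M \<theta> n R" and X: "wiener_integral M 0 f X"
  shows "L2_norm M (\<lambda>\<omega>. R X \<omega> - X \<omega>) = 0"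
proof -
  have iso: "L2_linear_isometry M R" and const: "AE \<omega> in M. R (\<lambda>_. c) \<omega> = c" for c
    using R by (auto simp: phase_isometry_def)
  obtain L where L: "L2_tendsto M (\<lambda>N. elementary_integral 0 (L N)) X"
    using X by (auto simp: wiener_integral_def)
  note L' = L2_tendstoD[OF L]
  let ?d = "\<lambda>N. L2_norm M (\<lambda>\<omega>. elementary_integral 0 (L N) \<omega> - X \<omega>)"
  have "L2_norm M (\<lambda>\<omega>. R X \<omega> - X \<omega>) \<le> 2 * ?d N" for N
  proof -
    \<comment> \<open>For k = 0 the product of increments is empty, so the elementary integral is
      the sum of the coefficients.\<close>
    define c where "c = (\<lambda>_::real \<Rightarrow> real. sum_list (map fst (L N)))"
    have c_eq: "elementary_integral 0 (L N) = c"
      by (simp add: fun_eq_iff elementary_integral_alt c_def)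
    then have c: "c \<in> L2 M"
      using L'(1)[of N] by simp
    note L2s = c L'(2) L2_linear_isometryD(1)[OF iso]
    have "L2_norm M (\<lambda>\<omega>. R X \<omega> - X \<omega>) =
        L2_norm M (\<lambda>\<omega>. (-1) * (R c \<omega> - R X \<omega>) + 1 * (c \<omega> - X \<omega>))"
      using const[of "sum_list (map fst (L N))"]
      by (intro L2_norm_cong_AE L2_diff L2_lincomb L2s) (auto simp: c_def)
    also have "\<dots> \<le> cmod (-1) * L2_norm M (\<lambda>\<omega>. R c \<omega> - R X \<omega>) + cmod 1 * L2_norm M (\<lambda>\<omega>. c \<omega> - X \<omega>)"
      by (intro L2_norm_lincomb_le L2_diff L2s)
    also have "\<dots> = 2 * ?d N"
      by (simp add: L2_isometry_dist[OF iso c L'(2)] c_eq)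
    finally show ?thesis .
  qed
  then have "\<exists>N0. \<forall>N\<ge>N0. L2_norm M (\<lambda>\<omega>. R X \<omega> - X \<omega>) \<le> 2 * ?d N"
    by blast
  moreover have "(\<lambda>N. 2 * ?d N) \<longlonglongrightarrow> 2 * 0"
    by (intro tendsto_mult tendsto_const L'(3))
  ultimately have "L2_norm M (\<lambda>\<omega>. R X \<omega> - X \<omega>) \<le> 2 * 0"
    by (rule LIMSEQ_le_const[rotated])
  then show ?thesis
    using L2_norm_nonneg[of M "\<lambda>\<omega>. R X \<omega> - X \<omega>"] by simp
qed

text \<open>The partial sums converge to X and, R being isometric, their images converge to R X;
  orthogonality of the increments turns the squared norm of each partial increment into a
  sum.\<close>

lemma isometry_increment_sums:
  assumes R: "L2_linear_isometry M R" and Z: "\<And>k. Z k \<in> L2 M"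
    and X: "L2_tendsto M (\<lambda>K \<omega>. \<Sum>k<K::nat. Z k \<omega>) X"
    and orth: "\<And>k l. k \<noteq> l \<Longrightarrow>
      L2_inner M (\<lambda>\<omega>. R (Z k) \<omega> - Z k \<omega>) (\<lambda>\<omega>. R (Z l) \<omega> - Z l \<omega>) = 0"
  shows "(\<lambda>k. (L2_norm M (\<lambda>\<omega>. R (Z k) \<omega> - Z k \<omega>))\<^sup>2) sums (L2_norm M (\<lambda>\<omega>. R X \<omega> - X \<omega>))\<^sup>2"
proof -
  let ?S = "\<lambda>K \<omega>. \<Sum>k<K. Z k \<omega>" and ?D = "\<lambda>k \<omega>. R (Z k) \<omega> - Z k \<omega>"
  note X' = L2_tendstoD[OF X] and RL2 = L2_linear_isometryD(1)[OF R]
  have D: "?D k \<in> L2 M" for k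
    by (intro L2_diff RL2 Z)
  have "L2_tendsto M (\<lambda>K. R (?S K)) (R X)"
    unfolding L2_tendsto_iff using X' by (simp add: RL2 L2_isometry_dist[OF R])
  from L2_tendsto_norm[OF L2_tendsto_lincomb[OF this X, of 1 "-1"]]
  have "(\<lambda>K. (L2_norm M (\<lambda>\<omega>. R (?S K) \<omega> - ?S K \<omega>))\<^sup>2) \<longlonglongrightarrow> (L2_norm M (\<lambda>\<omega>. R X \<omega> - X \<omega>))\<^sup>2"
    by simp
  moreover have "(L2_norm M (\<lambda>\<omega>. R (?S K) \<omega> - ?S K \<omega>))\<^sup>2 = (\<Sum>k<K. (L2_norm M (?D k))\<^sup>2)" for K
  proof -
    have "L2_norm M (\<lambda>\<omega>. R (?S K) \<omega> - ?S K \<omega>) = L2_norm M (\<lambda>\<omega>. \<Sum>k<K. 1 * ?D k \<omega>)"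
    proof (rule L2_norm_cong_AE)
      show "(\<lambda>\<omega>. R (?S K) \<omega> - ?S K \<omega>) \<in> L2 M"
        by (intro L2_diff RL2 X')
      show "(\<lambda>\<omega>. \<Sum>k<K. 1 * ?D k \<omega>) \<in> L2 M"
        using D by (simp add: L2_sum)
      show "AE \<omega> in M. R (?S K) \<omega> - ?S K \<omega> = (\<Sum>k<K. 1 * ?D k \<omega>)"
        using L2_isometry_sum[where K = K, OF R Z] by eventually_elim (simp add: sum_subtractf)
    qed
    then have "complex_of_real ((L2_norm M (\<lambda>\<omega>. R (?S K) \<omega> - ?S K \<omega>))\<^sup>2) =
        complex_of_real (\<Sum>k<K. (L2_norm M (?D k))\<^sup>2)"
      using L2_pythagoras[where c = "\<lambda>_. 1" and d = "\<lambda>_. 1" and K = K, OF D orth] by (simp add: L2_inner_self)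
    then show ?thesis
      unfolding of_real_eq_iff .
  qed
  ultimately show ?thesis
    by (simp add: sums_def)
qed

text \<open>Opening the graph at the value selected by \<open>OU\<close> yields one family
  \<open>Z\<close> that expands X and A X simultaneously. The squared norm of A X then gives
  summability with weight k^2, and its inner product with X gives the form with weight k.\<close>

lemma OU_dirichlet_form_expansion:
  assumes W: "wiener_measure M" and dom: "X \<in> OU_domain M"
  shows "\<exists>Z. (\<forall>k. Z k \<in> wiener_chaos M k) \<and> L2_tendsto M (\<lambda>K \<omega>. \<Sum>k<K. Z k \<omega>) X \<and>
    summable (\<lambda>k. (real k)\<^sup>2 * (L2_norm M (Z k))\<^sup>2) \<and>
    2 * OU_dirichlet_form M X = complex_of_real (\<Sum>k. real k * (L2_norm M (Z k))\<^sup>2)"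
proof -
  have "OU_graph M X (OU M X)"
    using dom someI_ex[of "OU_graph M X"] by (simp add: OU_domain_def OU_def)
  then obtain Z where Z: "\<And>k. Z k \<in> wiener_chaos M k" "L2_tendsto M (\<lambda>K \<omega>. \<Sum>k<K. Z k \<omega>) X"
    and Y: "L2_tendsto M (\<lambda>K \<omega>. \<Sum>k<K. - (of_nat k / 2) * Z k \<omega>) (OU M X)"
    unfolding OU_graph_def by blast
  define A where "A k = (L2_norm M (Z k))\<^sup>2" for k
  have ZL2: "Z k \<in> L2 M" for k
    using Z(1)[of k] by (auto simp: wiener_chaos_def intro: wiener_integral_L2)
  have orth: "L2_inner M (Z k) (Z l) = 0" if "k \<noteq> l" for k l
    using Z(1)[of k] Z(1)[of l] that by (auto simp: wiener_chaos_def wiener_integral_inner[OF W])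
  have pyth: "L2_inner M (\<lambda>\<omega>. \<Sum>k<K. c k * Z k \<omega>) (\<lambda>\<omega>. \<Sum>k<K. d k * Z k \<omega>) =
      (\<Sum>k<K. c k * cnj (d k) * (L2_norm M (Z k))\<^sup>2)" for c d K
    by (rule L2_pythagoras[OF ZL2]) (rule orth)
  have "complex_of_real ((L2_norm M (\<lambda>\<omega>. \<Sum>k<K. - (of_nat k / 2) * Z k \<omega>))\<^sup>2) =
      complex_of_real (\<Sum>k<K. (real k)\<^sup>2 * A k / 4)" for K
    unfolding L2_inner_self[symmetric] pyth A_def
    by (simp add: L2_inner_self power2_eq_square)
  then have "(L2_norm M (\<lambda>\<omega>. \<Sum>k<K. - (of_nat k / 2) * Z k \<omega>))\<^sup>2 = (\<Sum>k<K. (real k)\<^sup>2 * A k / 4)" for K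
    unfolding of_real_eq_iff .
  then have "(\<lambda>k. (real k)\<^sup>2 * A k / 4) sums (L2_norm M (OU M X))\<^sup>2"
    using L2_tendsto_norm[OF Y] by (simp add: sums_def)
  from sums_summable[OF sums_mult[OF this, of 4]] have summ: "summable (\<lambda>k. (real k)\<^sup>2 * A k)"
    by simp
  have "norm (real k * A k) \<le> (real k)\<^sup>2 * A k" for k
  proof -
    have "real k \<le> (real k)\<^sup>2"
      by (cases k) (auto simp: power2_eq_square)
    then show ?thesis
      by (simp add: A_def mult_right_mono)
  qed
  then have "summable (\<lambda>k. real k * A k)"
    by (rule summable_comparison_test'[OF summ])
  then have "(\<lambda>K. complex_of_real (\<Sum>k<K. real k * A k)) \<longlonglongrightarrow> complex_of_real (\<Sum>k. real k * A k)"
    by (intro tendsto_of_real summable_LIMSEQ)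
  moreover have "(\<lambda>K. complex_of_real (\<Sum>k<K. real k * A k)) \<longlonglongrightarrow> 2 * OU_dirichlet_form M X"
  proof -
    have "(\<lambda>K. L2_inner M (\<lambda>\<omega>. \<Sum>k<K. - (of_nat k / 2) * Z k \<omega>) (\<lambda>\<omega>. \<Sum>k<K. 1 * Z k \<omega>)) \<longlonglongrightarrow>
        L2_inner M (OU M X) X"
      using L2_tendsto_inner[OF Y Z(2)] by simp
    then have "(\<lambda>K. (-2) * L2_inner M (\<lambda>\<omega>. \<Sum>k<K. - (of_nat k / 2) * Z k \<omega>) (\<lambda>\<omega>. \<Sum>k<K. 1 * Z k \<omega>))
        \<longlonglongrightarrow> (-2) * L2_inner M (OU M X) X"
      by (intro tendsto_mult tendsto_const)
    also have "(-2) * L2_inner M (OU M X) X = 2 * OU_dirichlet_form M X"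
      by (simp add: OU_dirichlet_form_def L2_inner_def mult.commute)
    also have "(\<lambda>K. (-2) * L2_inner M (\<lambda>\<omega>. \<Sum>k<K. - (of_nat k / 2) * Z k \<omega>) (\<lambda>\<omega>. \<Sum>k<K. 1 * Z k \<omega>)) =
        (\<lambda>K. complex_of_real (\<Sum>k<K. real k * A k))"
      unfolding pyth A_def by (simp add: sum_distrib_left)
    finally show ?thesis .
  qed
  ultimately have "2 * OU_dirichlet_form M X = complex_of_real (\<Sum>k. real k * A k)"
    by (rule LIMSEQ_unique[symmetric])
  with Z summ show ?thesis
    by (intro exI[of _ Z]) (auto simp: A_def)
qed

text \<open>The two domains differ by the null set {0}; the theorem normalises \<theta> on the
  closed interval, the averaging argument on a half-open period.\<close>

lemma integral_Icc_01_eq_Ioc: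
  fixes h :: "real \<Rightarrow> real"
  assumes "h \<in> borel_measurable borel"
  shows "(LINT x|lborel. indicator {0<..1} x * h x) = (LINT x:{0..1}|lborel. h x)"
  unfolding set_lebesgue_integral_def real_scaleR_def
proof (rule integral_cong_AE)
  show "AE x in lborel. indicator {0<..1} x * h x = indicator {0..1} x * h x"
    using AE_lborel_singleton[of 0] by eventually_elim (auto simp: indicator_def)
qed (use assms in auto)

section \<open>Termwise limits and summation over the chaoses\<close>

theorem theorem9:
  fixes M :: "(real \<Rightarrow> real) measure"
    and \<theta> :: "real \<Rightarrow> real"
    and R :: "nat \<Rightarrow> ((real \<Rightarrow> real) \<Rightarrow> complex) \<Rightarrow> ((real \<Rightarrow> real) \<Rightarrow> complex)"
    and X :: "(real \<Rightarrow> real) \<Rightarrow> complex"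
  assumes "wiener_measure M"
    and "\<theta> \<in> borel_measurable borel"
    and "bounded (range \<theta>)"
    and "\<And>s. \<theta> (s + 1) = \<theta> s"
    and "(LINT s:{0..1}|lborel. \<theta> s) = 0"
    and "(LINT s:{0..1}|lborel. (\<theta> s)\<^sup>2) = 1"
    and "\<And>n. n \<ge> 1 \<Longrightarrow> phase_isometry M \<theta> n (R n)"
    and "X \<in> OU_domain M"
  shows "(\<lambda>n. complex_of_real ((real n)\<^sup>2 * (LINT \<omega>|M. (cmod (R n X \<omega> - X \<omega>))\<^sup>2)))
           \<longlonglongrightarrow> 2 * OU_dirichlet_form M X"
proof -
  note W = assms(1) and phase = assms(7)
  obtain C0 where C0: "\<And>x. \<bar>\<theta> x\<bar> \<le> C0"
    using assms(3) by (auto simp: bounded_iff)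
  define C where "C = max 1 C0"
  interpret oscillation \<theta> C
  proof
    show "\<bar>\<theta> x\<bar> \<le> C" for x
      using C0[of x] by (simp add: C_def)
  qed (use assms(2,4,5,6) in \<open>simp_all add: C_def integral_Icc_01_eq_Ioc\<close>)
  obtain Z where Z: "\<forall>k. Z k \<in> wiener_chaos M k" "L2_tendsto M (\<lambda>K \<omega>. \<Sum>k<K. Z k \<omega>) X"
    and summ: "summable (\<lambda>k. (real k)\<^sup>2 * (L2_norm M (Z k))\<^sup>2)"
    and form: "2 * OU_dirichlet_form M X = complex_of_real (\<Sum>k. real k * (L2_norm M (Z k))\<^sup>2)"
    using OU_dirichlet_form_expansion[OF W assms(8)] by blast
  have "\<forall>k. \<exists>g. g \<in> L2_sym k \<and> wiener_integral M k g (Z k)"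
    using Z(1) by (auto simp: wiener_chaos_def)
  then obtain f where "\<forall>k. f k \<in> L2_sym k \<and> wiener_integral M k (f k) (Z k)"
    by (rule choice[THEN exE])
  then have f: "f k \<in> L2_sym k" "wiener_integral M k (f k) (Z k)" for k
    by auto
  have ZL2: "Z k \<in> L2 M" for k
    using wiener_integral_L2(2)[OF f(2)] .
  have iso: "L2_linear_isometry M (R n)" if "n \<ge> 1" for n
    using phase[OF that] by (simp add: phase_isometry_def)
  define D where "D n k \<omega> = R n (Z k) \<omega> - Z k \<omega>" for n k \<omega>
  have DL2: "D n k \<in> L2 M" if "n \<ge> 1" for n k
    unfolding D_def[abs_def] by (intro L2_diff ZL2 L2_linear_isometryD(1)[OF iso[OF that]])
  have kernel: "wiener_integral M k
      (\<lambda>s. f k s * (\<Prod>j<k. exp (\<i> / of_nat n * complex_of_real (\<theta> (real n * s j))))) (R n (Z k))"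
    if "n \<ge> 1" "k \<ge> 1" for n k
    using phase[OF that(1)] f[of k] that(2) unfolding phase_isometry_def by blast
  have D0: "L2_norm M (D n 0) = 0" if "n \<ge> 1" for n
    unfolding D_def[abs_def] by (rule phase_isometry_chaos_0[OF phase[OF that] f(2)])
  have orth: "L2_inner M (D n k) (D n l) = 0" if n: "n \<ge> 1" and "k \<noteq> l" for n k l
  proof (cases "k = 0 \<or> l = 0")
    \<comment> \<open>The increment of order 0 has norm 0, so Cauchy-Schwarz gives orthogonality
      where the kernel rule does not reach.\<close>
    case True
    then show ?thesis
      using L2_inner_bound[OF DL2[OF n, of k] DL2[OF n, of l]] D0[OF n] by auto
  next
    case False
    then show ?thesis
      using wiener_integral_diff_inner[OF W kernel[OF n, of k] f(2)[of k] kernel[OF n, of l] f(2)[of l]]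
        \<open>k \<noteq> l\<close>
      unfolding D_def[abs_def] by simp
  qed
  have D_norm: "(L2_norm M (D n k))\<^sup>2 =
      (LINT s|simplex_measure k. (cmod (f k s))\<^sup>2 * (cmod (iexp (osc k \<theta> n s / real n) - 1))\<^sup>2)"
    if n: "n \<ge> 1" and k: "k \<ge> 1" for n k
  proof -
    have "complex_of_real ((L2_norm M (D n k))\<^sup>2) = complex_of_real ((L2_norm (simplex_measure k)
        (\<lambda>s. f k s * (\<Prod>j<k. exp (\<i> / of_nat n * complex_of_real (\<theta> (real n * s j)))) - f k s))\<^sup>2)"
      using wiener_integral_diff_inner[OF W kernel[OF n k] f(2)[of k] kernel[OF n k] f(2)[of k]]
      unfolding L2_inner_self D_def[abs_def] by (simp only: refl if_True)
    then show ?thesis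
      unfolding of_real_eq_iff L2_norm_power2 phase_kernel_diff .
  qed
  have norm_Z: "(L2_norm M (Z k))\<^sup>2 = (LINT s|simplex_measure k. (cmod (f k s))\<^sup>2)" for k
    unfolding wiener_integral_norm[OF W f(2)] by (rule L2_norm_power2)
  define a where "a k n = (real n)\<^sup>2 * (L2_norm M (D n k))\<^sup>2" for k n
  have lim: "(\<lambda>n. a k n) \<longlonglongrightarrow> real k * (L2_norm M (Z k))\<^sup>2" for k
  proof (cases "k \<ge> 1")
    case True
    obtain L where L: "\<And>N. elementary k (L N)"
      "L2_tendsto (simplex_measure k) (\<lambda>N. elementary_fun k (L N)) (f k)"
      using f(2)[of k] by (auto simp: wiener_integral_def)
    \<comment> \<open>The kernel formula for the norm holds from n = 1 on, so the limit is
      transferred along eventual equality.\<close>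
    show ?thesis
      unfolding norm_Z a_def
      by (rule Lim_transform_eventually[OF phase_diff_tendsto[OF L]],
          rule eventually_mono[OF eventually_ge_at_top[of 1]]) (simp add: D_norm[OF _ True])
  next
    case False
    then have k: "k = 0"
      by simp
    then have "\<forall>\<^sub>F n in sequentially. 0 = a k n"
      using D0 by (auto simp: a_def intro!: eventually_mono[OF eventually_ge_at_top[of 1]])
    then show ?thesis
      using k by (auto intro: Lim_transform_eventually[OF tendsto_const])
  qed
  have bound: "norm (a k n) \<le> C\<^sup>2 * ((real k)\<^sup>2 * (L2_norm M (Z k))\<^sup>2)" for k n
  proof (cases "n \<ge> 1 \<and> k \<ge> 1")
    case True
    then show ?thesis
      using phase_diff_le[OF wiener_integral_L2(1)[OF f(2)], of n k]
      by (simp add: a_def D_norm norm_Z power_mult_distrib mult_ac)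
  next
    case False
    \<comment> \<open>The domination is proved at every index: for n = 0 the prefactor vanishes
      whatever \<open>R 0\<close> is, and for k = 0 the increment has norm 0.\<close>
    then have "n = 0 \<or> n \<ge> 1 \<and> k = 0"
      by linarith
    then have "a k n = 0"
      using D0[of n] by (auto simp: a_def)
    then show ?thesis by simp
  qed
  have "(\<lambda>n. \<Sum>k. a k n) \<longlonglongrightarrow> (\<Sum>k. real k * (L2_norm M (Z k))\<^sup>2)"
    using tannerys_theorem[OF lim _ summable_mult[OF summ, of "C\<^sup>2"]] bound
    by (auto simp: case_prod_unfold)
  moreover have "\<forall>\<^sub>F n in sequentially.
      (\<Sum>k. a k n) = (real n)\<^sup>2 * (LINT \<omega>|M. (cmod (R n X \<omega> - X \<omega>))\<^sup>2)"
  proof (rule eventually_mono[OF eventually_ge_at_top[of 1]])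
    fix n :: nat assume n: "1 \<le> n"
    have "(\<lambda>k. (L2_norm M (D n k))\<^sup>2) sums (L2_norm M (\<lambda>\<omega>. R n X \<omega> - X \<omega>))\<^sup>2"
      using isometry_increment_sums[OF iso[OF n] ZL2 Z(2)] orth[OF n] by (simp add: D_def[abs_def])
    from sums_unique[OF sums_mult[OF this, of "(real n)\<^sup>2"]]
    show "(\<Sum>k. a k n) = (real n)\<^sup>2 * (LINT \<omega>|M. (cmod (R n X \<omega> - X \<omega>))\<^sup>2)"
      by (simp add: a_def L2_norm_power2)
  qed
  ultimately have "(\<lambda>n. (real n)\<^sup>2 * (LINT \<omega>|M. (cmod (R n X \<omega> - X \<omega>))\<^sup>2))
      \<longlonglongrightarrow> (\<Sum>k. real k * (L2_norm M (Z k))\<^sup>2)"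
    by (rule Lim_transform_eventually)
  then show ?thesis
    unfolding form tendsto_of_real_iff .
qed

end
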